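(* Let $c>0$ and $F\in\mathcal{F}_c$. Then the following are equivalent. (a) $F$ is extremal for one of the interior extremal problems $$\max_{f\in\mathcal{F}_c}f^{\sharp}(0)\quad\text{or}\quad\min_{f\in\mathcal{F}_c}f^{\sharp}(0),$$ i.e. $F^\sharp(0)\ge f^\sharp(0)$ for all $f\in\mathcal{F}_c$, or $F^\sharp(0)\le f^\sharp(0)$ for all $f\in\mathcal{F}_c$. (b) $F$ is extremal for the boundary extremal problem $$\min_{f\in\mathcal{F}_c}\ \limsup_{z\to\xi}f^{\sharp}(z)\quad\text{for every }\xi\in\partial\mathbb{D},$$ i.e. for every $\xi\in\partial\mathbb{D}$ and every $f\in\mathcal{F}_c$ one has $\limsup_{z\to\xi}F^\sharp(z)\le\limsup_{z\to\xi}f^\sharp(z)$ (with $z\in\mathbb{D}$).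
   Context: $\mathbb{D}=\{z\in\mathbb{C}:|z|<1\}$, and $\mathcal{M}(\mathbb{D})$ is the set of all meromorphic functions in $\mathbb{D}$. For $f\in\mathcal{M}(\mathbb{D})$ the spherical derivative is $f^{\sharp}(z)=\frac{|f'(z)|}{1+|f(z)|^2}$, extended continuously to the poles of $f$ (equivalently $f^\sharp=(1/f)^\sharp$ near a pole). For $c>0$, $\mathcal{F}_c=\{f\in\mathcal{M}(\mathbb{D}): f^{\sharp}(z)\ge c\text{ for all }z\in\mathbb{D}\}$. *)

theory Defs
  imports "HOL-Complex_Analysis.Complex_Analysis"
begin

(* At a pole the value is the limit of the defining quotient, i.e. the continuous extension;
   the junk value that f itself takes there is not used. *)
definition sph_deriv :: "(complex \<Rightarrow> complex) \<Rightarrow> complex \<Rightarrow> real" where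
  "sph_deriv f z =
     (if is_pole f z then Lim (at z) (\<lambda>w. cmod (deriv f w) / (1 + (cmod (f w))\<^sup>2))
      else cmod (deriv f z) / (1 + (cmod (f z))\<^sup>2))"

(* nicely_meromorphic_on rather than meromorphic_on: the latter allows arbitrary values at
   removable singularities, where deriv f would then be meaningless. The nice representative
   is analytic at every point of the disc that is not a pole (and is 0 at poles). *)
definition F_class :: "real \<Rightarrow> (complex \<Rightarrow> complex) set" where
  "F_class c = {f. f nicely_meromorphic_on ball 0 1 \<and> (\<forall>z\<in>ball 0 1. c \<le> sph_deriv f z)}"

end

theory Submission
  imports Defs
begin

text \<open>
  Why the two kinds of extremality coincide. A function \<open>f\<close> in the class has simple poles only and
  nowhere vanishing derivative, so \<open>1/f'\<close>, extended by \<open>0\<close> at the poles, is holomorphic with double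
  zeros and is the square of a holomorphic \<open>b\<close>. With \<open>a = f b\<close> we get \<open>f = a/b\<close>, Wronskian
  \<open>a' b - a b' = 1\<close>, and \<open>1 / f\<^sup>\<sharp> = |a|\<^sup>2 + |b|\<^sup>2\<close>. Everything is thus about a holomorphic map
  \<open>w = (a, b)\<close> from the disc into \<open>\<complex>\<^sup>2\<close> with \<open>det (w, w') = \<plusminus>1\<close> and \<open>|w|\<^sup>2 \<le> 1/c\<close>; let \<open>w\<^sub>n\<close> be its
  Taylor coefficients.

  Interior problem. Parseval on circles gives \<open>|w\<^sub>0|\<^sup>2 + |w\<^sub>1|\<^sup>2 \<le> 1/c\<close>, and \<open>|w\<^sub>0| |w\<^sub>1| \<ge> 1\<close> since
  \<open>det (w\<^sub>0, w\<^sub>1) = \<plusminus>1\<close>. Hence \<open>x = f\<^sup>\<sharp>(0)\<close> satisfies \<open>x + 1/x \<le> 1/c\<close>. The functions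
  \<open>z \<mapsto> \<eta> z\<close> with \<open>\<eta> + 1/\<eta> = 1/c\<close> attain both ends of the interval
  that this inequality allows for \<open>x\<close>, so interior extremality means equality
  \<open>x + 1/x = 1/c\<close> (\<open>interior_extremal_iff\<close>).

  Boundary problem. These test functions have \<open>f\<^sup>\<sharp> \<rightarrow> c\<close> at every boundary point, the smallest value
  possible, so boundary extremality means \<open>f\<^sup>\<sharp> \<rightarrow> c\<close>, that is \<open>|w|\<^sup>2 \<rightarrow> 1/c\<close>, at the whole boundary
  (\<open>boundary_extremal_iff\<close>).

  It remains to see that \<open>x + 1/x = 1/c\<close> holds exactly if \<open>|w|\<^sup>2\<close> tends to \<open>1/c\<close> at the boundary. One
  direction is the equality case of Parseval: all coefficients from \<open>w\<^sub>2\<close> on vanish and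
  \<open>w\<^sub>0 \<bottom> w\<^sub>1\<close> (\<open>extremal_is_radial\<close>). The other direction is a symmetry statement for the Liouville
  equation \<open>\<Delta>u = -4 e\<^bsup>2u\<^esup>\<close>, \<open>u = ln f\<^sup>\<sharp>\<close>, with constant boundary values. It rests on a Pohozaev type
  identity: the components of \<open>w\<close> solve \<open>w'' = - q w\<close> with \<open>q\<close> holomorphic, so on circles the mean of
  \<open>\<langle>z\<^sup>2 w'', w\<rangle>\<close> equals both \<open>\<Sum>n (n-1) |w\<^sub>n|\<^sup>2 r\<^bsup>2n\<^esup>\<close> and the mean of \<open>z\<^sup>2 q (1/c - |w|\<^sup>2)\<close>, because
  \<open>z\<^sup>2 q\<close> has mean \<open>0\<close> (\<open>pohozaev\<close>). If the right-hand side tends to \<open>0\<close> as \<open>r \<rightarrow> 1\<close>, then \<open>w\<close> is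
  affine, and constancy of \<open>|w|\<close> on the unit circle then makes \<open>w\<^sub>0\<close> and \<open>w\<^sub>1\<close> orthogonal, whence
  \<open>x + 1/x = 1/c\<close>. The limit is justified by the linear decay \<open>1/c - |w|\<^sup>2 = O(1 - |z|)\<close>, which
  comes from a maximum principle (\<open>boundary_decay\<close>), and by the estimate \<open>q = O(1 / (1 - |z|))\<close>, which
  comes from a Caratheodory coefficient bound (\<open>q_bound\<close>). Together they bound the right-hand side,
  hence the sum on the left, and the summability gained in this way improves the estimate of \<open>q\<close> in
  quadratic mean to the \<open>o(1 / (1 - r))\<close> that is needed (\<open>constant_boundary_values_imp_affine\<close>).
\<close>

section \<open>Means over circles and Parseval's identity\<close>

definition circle_mean :: "real \<Rightarrow> (complex \<Rightarrow> complex) \<Rightarrow> complex" where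
  "circle_mean r h = integral {0..1} (\<lambda>t. h (of_real r * cis (2 * pi * t)))"

lemma norm_circle_point [simp]:
  "cmod (of_real r * cis (2 * pi * t)) = \<bar>r\<bar>"
  by (simp add: norm_mult)

lemma continuous_on_circle:
  fixes h :: "complex \<Rightarrow> complex"
  assumes "continuous_on (sphere 0 r) h" "0 \<le> r"
  shows "continuous_on {0..1} (\<lambda>t. h (of_real r * cis (2 * pi * t)))"
  by (rule continuous_on_compose2[OF assms(1)]) (use assms in \<open>auto intro!: continuous_intros\<close>)

lemma circle_mean_integrable:
  fixes h :: "complex \<Rightarrow> complex"
  assumes "continuous_on (sphere 0 r) h" "0 \<le> r"
  shows "(\<lambda>t. h (of_real r * cis (2 * pi * t))) integrable_on {0..1}"
  by (rule integrable_continuous_real[OF continuous_on_circle[OF assms]])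

lemma circle_mean_add:
  assumes "continuous_on (sphere 0 r) g" "continuous_on (sphere 0 r) h" "0 \<le> r"
  shows "circle_mean r (\<lambda>z. g z + h z) = circle_mean r g + circle_mean r h"
  unfolding circle_mean_def
  by (rule integral_add) (use assms in \<open>auto intro: circle_mean_integrable\<close>)

lemma circle_mean_minus: "circle_mean r (\<lambda>z. - h z) = - circle_mean r h"
  by (simp add: circle_mean_def)

lemma circle_mean_cmult: "circle_mean r (\<lambda>z. c * h z) = c * circle_mean r h"
  by (simp add: circle_mean_def)

lemma circle_mean_cnj: "circle_mean r (\<lambda>z. cnj (h z)) = cnj (circle_mean r h)"
  by (simp add: circle_mean_def integral_cnj)

lemma circle_mean_cong:
  assumes "\<And>z. cmod z = r \<Longrightarrow> g z = h z" "0 \<le> r"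
  shows "circle_mean r g = circle_mean r h"
  unfolding circle_mean_def by (rule integral_cong) (use assms in auto)

lemma norm_circle_mean_le:
  assumes "continuous_on (sphere 0 r) g" "continuous_on (sphere 0 r) h" "0 \<le> r"
    and "\<And>z. cmod z = r \<Longrightarrow> cmod (g z) \<le> Re (h z)"
  shows "cmod (circle_mean r g) \<le> Re (circle_mean r h)"
proof -
  have h: "(\<lambda>t. h (of_real r * cis (2 * pi * t))) integrable_on {0..1}"
    and g: "(\<lambda>t. g (of_real r * cis (2 * pi * t))) integrable_on {0..1}"
    using circle_mean_integrable assms by auto
  have hr: "(\<lambda>t. Re (h (of_real r * cis (2 * pi * t)))) integrable_on {0..1}"
    using integrable_component[OF h, of 1] by simp
  have "cmod (circle_mean r g) \<le> integral {0..1} (\<lambda>t. Re (h (of_real r * cis (2 * pi * t))))"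
    unfolding circle_mean_def
    by (rule integral_norm_bound_integral[OF g hr]) (use assms in auto)
  also have "\<dots> = Re (circle_mean r h)"
    unfolding circle_mean_def using integral_component_eq[OF h, of 1] by simp
  finally show ?thesis .
qed

lemma Re_circle_mean_le:
  assumes "continuous_on (sphere 0 r) h" "0 \<le> r" "\<And>z. cmod z = r \<Longrightarrow> Re (h z) \<le> B"
  shows "Re (circle_mean r h) \<le> B"
proof -
  have h: "(\<lambda>t. h (of_real r * cis (2 * pi * t))) integrable_on {0..1}"
    using circle_mean_integrable assms by auto
  have hr: "(\<lambda>t. Re (h (of_real r * cis (2 * pi * t)))) integrable_on {0..1}"
    using integrable_component[OF h, of 1] by simp
  have "Re (circle_mean r h) = integral {0..1} (\<lambda>t. Re (h (of_real r * cis (2 * pi * t))))"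
    unfolding circle_mean_def using integral_component_eq[OF h, of 1] by simp
  also have "\<dots> \<le> integral {0..1} (\<lambda>t::real. B)"
    by (rule integral_le[OF hr]) (use assms in auto)
  finally show ?thesis by simp
qed

lemma cis_integral_orthogonal:
  "integral {0..1} (\<lambda>t. cis (2 * pi * t) ^ m * cnj (cis (2 * pi * t) ^ n)) = (if m = n then 1 else 0)"
proof (cases "m = n")
  case True
  have "cis (2 * pi * t) ^ m * cnj (cis (2 * pi * t) ^ n) = 1" for t
    using True complex_norm_square[of "cis (2 * pi * t) ^ n"] by (simp add: norm_power)
  then show ?thesis using True by simp
next
  case False
  define k where "k = 2 * pi * (real m - real n)"
  have k: "k \<noteq> 0" using False by (simp add: k_def)
  have e: "cis (2 * pi * t) ^ m * cnj (cis (2 * pi * t) ^ n) = cis (k * t)" for t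
    by (simp add: Complex.DeMoivre cis_cnj cis_mult k_def algebra_simps)
  have "((\<lambda>t. cis (k * t)) has_integral (cis (k * 1) / (\<i> * k) - cis (k * 0) / (\<i> * k))) {0..1}"
  proof (rule fundamental_theorem_of_calculus)
    fix x :: real
    have "((\<lambda>t. cis (k * t) / (\<i> * k)) has_vector_derivative (k *\<^sub>R (\<i> * cis (k * x))) / (\<i> * k))
        (at x within {0..1})"
      unfolding has_vector_derivative_def
      by (auto intro!: derivative_eq_intros simp: scaleR_conv_of_real algebra_simps)
    then show "((\<lambda>t. cis (k * t) / (\<i> * k)) has_vector_derivative cis (k * x)) (at x within {0..1})"
      using k by (simp add: scaleR_conv_of_real)
  qed auto
  moreover have "cis k = 1"
  proof -
    have "k = 2 * pi * of_int (int m - int n)" by (simp add: k_def)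
    then show ?thesis using cis_multiple_2pi[of "of_int (int m - int n)"] by simp
  qed
  ultimately show ?thesis using False e by (simp add: integral_unique)
qed

text \<open>Prepares the exchange of sum and integral in Parseval's identity.\<close>
lemma powser_uniform_limit_circle:
  fixes \<alpha> :: "nat \<Rightarrow> complex"
  assumes "\<And>z. z \<in> ball 0 1 \<Longrightarrow> (\<lambda>n. \<alpha> n * z ^ n) sums f z" "0 \<le> r" "r < 1"
  shows "uniform_limit {0..1} (\<lambda>N t. \<Sum>n<N. \<alpha> n * (of_real r * cis (2 * pi * t)) ^ n)
           (\<lambda>t. f (of_real r * cis (2 * pi * t))) sequentially"
    and "continuous_on {0..1} (\<lambda>t. f (of_real r * cis (2 * pi * t)))"
proof -
  obtain s where s: "r < s" "s < 1" using assms dense by blast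
  have "summable (\<lambda>n. \<alpha> n * (complex_of_real s) ^ n)"
    using assms(1)[of "of_real s"] s assms(2) by (auto simp: sums_iff)
  then have "ereal (norm (complex_of_real s)) \<le> conv_radius \<alpha>"
    by (rule conv_radius_geI)
  then have rad: "ereal r < conv_radius \<alpha>"
    using s assms by (auto intro: less_le_trans[of _ "ereal s"])
  have u: "uniform_limit (cball 0 r) (\<lambda>n x. \<Sum>i<n. \<alpha> i * x ^ i) (\<lambda>x. suminf (\<lambda>i. \<alpha> i * x ^ i)) sequentially"
    using powser_uniform_limit[OF rad, of 0] by simp
  have "uniform_limit {0..1} (\<lambda>N t. \<Sum>n<N. \<alpha> n * (of_real r * cis (2 * pi * t)) ^ n)
      (\<lambda>t. suminf (\<lambda>i. \<alpha> i * (of_real r * cis (2 * pi * t)) ^ i)) sequentially"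
    by (rule uniform_limit_compose'[OF u]) (use assms in auto)
  moreover have "suminf (\<lambda>i. \<alpha> i * (of_real r * cis (2 * pi * t)) ^ i) = f (of_real r * cis (2 * pi * t))" for t
    using assms(1)[of "of_real r * cis (2 * pi * t)"] assms by (auto simp: sums_iff norm_mult)
  ultimately show U: "uniform_limit {0..1} (\<lambda>N t. \<Sum>n<N. \<alpha> n * (of_real r * cis (2 * pi * t)) ^ n)
           (\<lambda>t. f (of_real r * cis (2 * pi * t))) sequentially"
    by simp
  show "continuous_on {0..1} (\<lambda>t. f (of_real r * cis (2 * pi * t)))"
    by (rule uniform_limit_theorem[OF _ U]) (auto intro!: continuous_intros always_eventually)
qed

text \<open>Parseval's identity in polarised form. The products of partial sums converge uniformly on the
  circle, and for them the identity is orthogonality of the characters.\<close>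
lemma parseval_powser:
  fixes \<alpha> \<beta> :: "nat \<Rightarrow> complex"
  assumes f: "\<And>z. z \<in> ball 0 1 \<Longrightarrow> (\<lambda>n. \<alpha> n * z ^ n) sums f z"
    and g: "\<And>z. z \<in> ball 0 1 \<Longrightarrow> (\<lambda>n. \<beta> n * z ^ n) sums g z" and r: "0 \<le> r" "r < 1"
  shows "(\<lambda>n. \<alpha> n * cnj (\<beta> n) * of_real (r ^ (2 * n))) sums circle_mean r (\<lambda>z. f z * cnj (g z))"
proof -
  define e where "e t = of_real r * cis (2 * pi * t)" for t
  define A where "A N t = (\<Sum>n<N. \<alpha> n * e t ^ n)" for N t
  define B where "B N t = (\<Sum>n<N. \<beta> n * e t ^ n)" for N t
  have uf: "uniform_limit {0..1} A (\<lambda>t. f (e t)) sequentially"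
    and cf: "continuous_on {0..1} (\<lambda>t. f (e t))"
    using powser_uniform_limit_circle[OF f r] by (simp_all add: A_def[abs_def] e_def)
  have ug: "uniform_limit {0..1} B (\<lambda>t. g (e t)) sequentially"
    and cg: "continuous_on {0..1} (\<lambda>t. g (e t))"
    using powser_uniform_limit_circle[OF g r] by (simp_all add: B_def[abs_def] e_def)
  have ug': "uniform_limit {0..1} (\<lambda>N t. cnj (B N t)) (\<lambda>t. cnj (g (e t))) sequentially"
    by (rule bounded_linear.uniform_limit[OF bounded_linear_cnj ug])
  have bf: "bounded ((\<lambda>t. f (e t)) ` {0..1})"
    by (intro compact_imp_bounded compact_continuous_image cf) auto
  have bg: "bounded ((\<lambda>t. cnj (g (e t))) ` {0..1})"
    by (intro compact_imp_bounded compact_continuous_image continuous_intros cg) auto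
  have u: "uniform_limit {0..1} (\<lambda>N t. A N t * cnj (B N t)) (\<lambda>t. f (e t) * cnj (g (e t))) sequentially"
    by (rule uniform_lim_mult[OF uf ug' bf bg])
  have cA: "continuous_on {0..1} (\<lambda>t. A N t * cnj (B N t))" for N
    unfolding A_def B_def e_def by (intro continuous_intros)
  obtain I J where I: "\<And>N. ((\<lambda>t. A N t * cnj (B N t)) has_integral I N) {0..1}"
    and J: "((\<lambda>t. f (e t) * cnj (g (e t))) has_integral J) {0..1}" and lim: "I \<longlonglongrightarrow> J"
    using uniform_limit_integral[OF u cA] by auto
  have "I N = (\<Sum>n<N. \<alpha> n * cnj (\<beta> n) * of_real (r ^ (2 * n)))" for N
  proof -
    have *: "\<alpha> m * e t ^ m * cnj (\<beta> n * e t ^ n)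
        = (\<alpha> m * cnj (\<beta> n) * of_real (r ^ (m + n))) * (cis (2 * pi * t) ^ m * cnj (cis (2 * pi * t) ^ n))" for m n t
      by (simp add: e_def power_mult_distrib power_add)
    have "A N t * cnj (B N t) = (\<Sum>m<N. \<Sum>n<N. (\<alpha> m * cnj (\<beta> n) * of_real (r ^ (m + n))) *
        (cis (2 * pi * t) ^ m * cnj (cis (2 * pi * t) ^ n)))" for t
      unfolding A_def B_def cnj_sum sum_product * ..
    then have "I N = integral {0..1} (\<lambda>t. \<Sum>m<N. \<Sum>n<N. (\<alpha> m * cnj (\<beta> n) * of_real (r ^ (m + n))) *
        (cis (2 * pi * t) ^ m * cnj (cis (2 * pi * t) ^ n)))"
      using I[of N] by (simp add: integral_unique)
    also have "\<dots> = (\<Sum>m<N. integral {0..1} (\<lambda>t. \<Sum>n<N. (\<alpha> m * cnj (\<beta> n) * of_real (r ^ (m + n))) *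
        (cis (2 * pi * t) ^ m * cnj (cis (2 * pi * t) ^ n))))"
      by (rule integral_sum) (auto intro!: integrable_continuous_real continuous_intros)
    also have "\<dots> = (\<Sum>m<N. \<Sum>n<N. integral {0..1} (\<lambda>t. (\<alpha> m * cnj (\<beta> n) * of_real (r ^ (m + n))) *
        (cis (2 * pi * t) ^ m * cnj (cis (2 * pi * t) ^ n))))"
      by (intro sum.cong refl integral_sum) (auto intro!: integrable_continuous_real continuous_intros)
    also have "\<dots> = (\<Sum>m<N. \<Sum>n<N. (\<alpha> m * cnj (\<beta> n) * of_real (r ^ (m + n))) * (if m = n then 1 else 0))"
      by (simp only: integral_mult_right cis_integral_orthogonal)
    also have "\<dots> = (\<Sum>n<N. \<alpha> n * cnj (\<beta> n) * of_real (r ^ (2 * n)))"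
      by (intro sum.cong refl) (simp add: mult_2 if_distrib sum.delta cong: if_cong)
    finally show ?thesis .
  qed
  then have "I = (\<lambda>N. \<Sum>n<N. \<alpha> n * cnj (\<beta> n) * of_real (r ^ (2 * n)))" by auto
  moreover have "J = circle_mean r (\<lambda>z. f z * cnj (g z))"
    using J by (simp add: circle_mean_def e_def integral_unique)
  ultimately show ?thesis using lim by (simp add: sums_def)
qed

text \<open>The mean value property, as Parseval's identity against the constant \<open>1\<close>.\<close>
lemma circle_mean_holomorphic:
  assumes "h holomorphic_on ball 0 1" "0 \<le> r" "r < 1"
  shows "circle_mean r h = h 0"
proof -
  have h: "(\<lambda>n. (deriv ^^ n) h 0 / fact n * z ^ n) sums h z" if "z \<in> ball 0 1" for z
    using holomorphic_power_series[OF assms(1) that] by simp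
  have one: "(\<lambda>n. (if n = 0 then 1 else 0) * z ^ n) sums (1::complex)" for z :: complex
    using sums_single[of 0 "\<lambda>n. z ^ n"] by (simp add: if_distrib[of "\<lambda>x. x * _"] cong: if_cong)
  have "(\<lambda>n. (deriv ^^ n) h 0 / fact n * cnj (if n = 0 then 1 else 0) * of_real (r ^ (2 * n)))
      sums circle_mean r (\<lambda>z. h z * cnj 1)"
    by (rule parseval_powser[OF h one assms(2,3)])
  moreover have "(\<lambda>n. (deriv ^^ n) h 0 / fact n * cnj (if n = 0 then 1 else 0) * of_real (r ^ (2 * n)))
      = (\<lambda>n. if n = 0 then h 0 else 0)" by auto
  ultimately show ?thesis using sums_unique2 sums_single[of 0 "\<lambda>_. h 0"] by fastforce
qed

text \<open>Caratheodory's bound for the second coefficient. On a circle the anti-holomorphic function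
  \<open>cnj p\<close> is orthogonal to \<open>z\<^sup>2\<close>, so the coefficient is already determined by the nonnegative
  function \<open>p + cnj p\<close>, whose mean is \<open>2 Re (p 0)\<close>.\<close>
lemma caratheodory_second_derivative:
  assumes p: "p holomorphic_on ball 0 1" and pos: "\<And>z. z \<in> ball 0 1 \<Longrightarrow> 0 \<le> Re (p z)"
  shows "cmod (deriv (deriv p) 0) \<le> 4 * Re (p 0)"
proof -
  have bound: "cmod (deriv (deriv p) 0 / 2) * r ^ 2 \<le> 2 * Re (p 0)" if r: "0 < r" "r < 1" for r
  proof -
    have cp: "continuous_on (sphere 0 r) p"
      using holomorphic_on_imp_continuous_on[OF p] by (rule continuous_on_subset) (use r in auto)
    have P: "(\<lambda>n. (deriv ^^ n) p 0 / fact n * z ^ n) sums p z" if "z \<in> ball 0 1" for z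
      using holomorphic_power_series[OF p that] by simp
    have sq: "(\<lambda>n. (if n = 2 then 1 else 0) * z ^ n) sums (z\<^sup>2)" for z :: complex
      using sums_single[of 2 "\<lambda>n. z ^ n"] by (simp add: if_distrib[of "\<lambda>x. x * _"] cong: if_cong)
    have "(\<lambda>n. (deriv ^^ n) p 0 / fact n * cnj (if n = 2 then 1 else 0) * of_real (r ^ (2 * n)))
        sums circle_mean r (\<lambda>z. p z * cnj (z\<^sup>2))"
      by (rule parseval_powser[OF P sq]) (use r in auto)
    moreover have "(\<lambda>n. (deriv ^^ n) p 0 / fact n * cnj (if n = 2 then 1 else 0) * of_real (r ^ (2 * n)))
        = (\<lambda>n. if n = 2 then deriv (deriv p) 0 / 2 * of_real (r ^ 4) else 0)"
      by (auto simp: eval_nat_numeral)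
    ultimately have m1: "circle_mean r (\<lambda>z. p z * cnj (z\<^sup>2)) = deriv (deriv p) 0 / 2 * of_real (r ^ 4)"
      using sums_unique2 sums_single[of 2 "\<lambda>_. deriv (deriv p) 0 / 2 * of_real (r ^ 4)"] by fastforce
    have "circle_mean r (\<lambda>z. p z * z\<^sup>2) = 0"
      by (subst circle_mean_holomorphic) (use p r in \<open>auto intro!: holomorphic_intros\<close>)
    then have m2: "circle_mean r (\<lambda>z. cnj (p z) * cnj (z\<^sup>2)) = 0"
      using circle_mean_cnj[of r "\<lambda>z. p z * z\<^sup>2"] by simp
    have "deriv (deriv p) 0 / 2 * of_real (r ^ 4) = circle_mean r (\<lambda>z. p z * cnj (z\<^sup>2) + cnj (p z) * cnj (z\<^sup>2))"
      by (subst circle_mean_add) (use r m1 m2 cp in \<open>auto intro!: continuous_intros\<close>)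
    also have "cmod \<dots> \<le> Re (circle_mean r (\<lambda>z. of_real (2 * r\<^sup>2) * p z))"
    proof (rule norm_circle_mean_le)
      fix z :: complex assume z: "cmod z = r"
      have "p z * cnj (z\<^sup>2) + cnj (p z) * cnj (z\<^sup>2) = of_real (2 * Re (p z)) * cnj (z\<^sup>2)"
        by (simp add: complex_add_cnj[symmetric] distrib_right del: of_real_mult)
      moreover have "0 \<le> Re (p z)" using pos[of z] z r by auto
      ultimately show "cmod (p z * cnj (z\<^sup>2) + cnj (p z) * cnj (z\<^sup>2)) \<le> Re (of_real (2 * r\<^sup>2) * p z)"
        using z by (simp add: norm_mult norm_power)
    qed (use r cp in \<open>auto intro!: continuous_intros\<close>)
    also have "\<dots> = 2 * r\<^sup>2 * Re (p 0)"
      using circle_mean_holomorphic[OF p, of r] r by (simp add: circle_mean_cmult del: of_real_mult of_real_power)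
    finally have "cmod (deriv (deriv p) 0 / 2) * r ^ 4 \<le> 2 * r\<^sup>2 * Re (p 0)"
      using r by (simp add: norm_mult norm_power)
    then have "r ^ 2 * (cmod (deriv (deriv p) 0 / 2) * r ^ 2) \<le> r ^ 2 * (2 * Re (p 0))"
      by (simp add: eval_nat_numeral algebra_simps)
    then show ?thesis using r by (simp only: mult_le_cancel_left_pos zero_less_power)
  qed
  have "((\<lambda>r. cmod (deriv (deriv p) 0 / 2) * r ^ 2) \<longlongrightarrow> cmod (deriv (deriv p) 0 / 2) * 1 ^ 2) (at_left (1::real))"
    by (intro tendsto_intros)
  moreover have "eventually (\<lambda>r::real. cmod (deriv (deriv p) 0 / 2) * r ^ 2 \<le> 2 * Re (p 0)) (at_left 1)"
    using eventually_at_left_real[of 0 1, OF zero_less_one] by (rule eventually_mono) (use bound in auto)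
  ultimately have "cmod (deriv (deriv p) 0 / 2) * 1 ^ 2 \<le> 2 * Re (p 0)"
    by (rule tendsto_upperbound) auto
  then show ?thesis by (simp add: norm_divide)
qed

section \<open>Pairs of holomorphic functions with Wronskian one\<close>

definition energy :: "(complex \<Rightarrow> complex) \<Rightarrow> (complex \<Rightarrow> complex) \<Rightarrow> complex \<Rightarrow> real" where
  "energy a b z = (cmod (a z))\<^sup>2 + (cmod (b z))\<^sup>2"

definition taylor :: "(complex \<Rightarrow> complex) \<Rightarrow> nat \<Rightarrow> complex" where
  "taylor f n = (deriv ^^ n) f 0 / fact n"

lemma taylor_0 [simp]: "taylor f 0 = f 0" and taylor_1 [simp]: "taylor f (Suc 0) = deriv f 0"
  by (simp_all add: taylor_def)

lemma taylor_sums: "f holomorphic_on ball 0 1 \<Longrightarrow> z \<in> ball 0 1 \<Longrightarrow> (\<lambda>n. taylor f n * z ^ n) sums f z"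
  using holomorphic_power_series[of f 0 1 z] by (simp add: taylor_def)

definition coeff_energy :: "(complex \<Rightarrow> complex) \<Rightarrow> (complex \<Rightarrow> complex) \<Rightarrow> nat \<Rightarrow> real" where
  "coeff_energy a b n = (cmod (taylor a n))\<^sup>2 + (cmod (taylor b n))\<^sup>2"

lemma energy_parseval:
  assumes a: "a holomorphic_on ball 0 1" and b: "b holomorphic_on ball 0 1" and r: "0 \<le> r" "r < 1"
  shows "(\<lambda>n. coeff_energy a b n * r ^ (2 * n)) sums
           Re (circle_mean r (\<lambda>z. of_real (energy a b z)))"
proof -
  have ca: "continuous_on (sphere 0 r) a" and cb: "continuous_on (sphere 0 r) b"
    using holomorphic_on_imp_continuous_on[OF a] holomorphic_on_imp_continuous_on[OF b] r
    by (auto elim!: continuous_on_subset)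
  have "(\<lambda>n. taylor a n * cnj (taylor a n) * of_real (r ^ (2 * n)) + taylor b n * cnj (taylor b n) * of_real (r ^ (2 * n)))
     sums (circle_mean r (\<lambda>z. a z * cnj (a z)) + circle_mean r (\<lambda>z. b z * cnj (b z)))"
    by (intro sums_add parseval_powser taylor_sums a b r) 
  also have "circle_mean r (\<lambda>z. a z * cnj (a z)) + circle_mean r (\<lambda>z. b z * cnj (b z))
     = circle_mean r (\<lambda>z. a z * cnj (a z) + b z * cnj (b z))"
    by (rule circle_mean_add[symmetric]) (use r ca cb in \<open>auto intro!: continuous_intros\<close>)
  also have "(\<lambda>z. a z * cnj (a z) + b z * cnj (b z)) = (\<lambda>z. of_real (energy a b z))"
    by (simp add: energy_def complex_norm_square[symmetric])
  finally have "(\<lambda>n. Re (taylor a n * cnj (taylor a n) * of_real (r ^ (2 * n)) + taylor b n * cnj (taylor b n) * of_real (r ^ (2 * n))))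
     sums Re (circle_mean r (\<lambda>z. of_real (energy a b z)))"
    by (rule sums_Re)
  moreover have "Re (taylor a n * cnj (taylor a n) * of_real (r ^ (2 * n)) + taylor b n * cnj (taylor b n) * of_real (r ^ (2 * n)))
      = coeff_energy a b n * r ^ (2 * n)" for n
  proof -
    have "Re (c * cnj c * of_real x) = (cmod c)\<^sup>2 * x" for c x
      by (metis Re_complex_of_real complex_norm_square of_real_mult)
    then show ?thesis by (simp only: coeff_energy_def plus_complex.sel distrib_right)
  qed
  ultimately show ?thesis by simp
qed

lemma continuous_on_energy:
  "a holomorphic_on S \<Longrightarrow> b holomorphic_on S \<Longrightarrow> continuous_on S (energy a b)"
  unfolding energy_def by (intro continuous_intros holomorphic_on_imp_continuous_on)

text \<open>Parseval's identity and the bound on every circle, in the limit of the unit circle.\<close>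
lemma sum_energy_taylor_le:
  assumes a: "a holomorphic_on ball 0 1" and b: "b holomorphic_on ball 0 1"
    and bound: "\<And>z. z \<in> ball 0 1 \<Longrightarrow> energy a b z \<le> B" and "finite I"
  shows "(\<Sum>n\<in>I. coeff_energy a b n) \<le> B"
proof -
  let ?P = "\<lambda>n. coeff_energy a b n"
  have *: "(\<Sum>n\<in>I. ?P n * r ^ (2 * n)) \<le> B" if r: "0 < r" "r < 1" for r
  proof -
    have s: "(\<lambda>n. ?P n * r ^ (2 * n)) sums Re (circle_mean r (\<lambda>z. of_real (energy a b z)))"
      using energy_parseval[OF a b, of r] r by simp
    have "(\<Sum>n\<in>I. ?P n * r ^ (2 * n)) \<le> suminf (\<lambda>n. ?P n * r ^ (2 * n))"
      by (rule sum_le_suminf) (use s \<open>finite I\<close> r in \<open>auto simp: sums_iff coeff_energy_def\<close>)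
    also have "\<dots> = Re (circle_mean r (\<lambda>z. of_real (energy a b z)))" using s by (simp add: sums_iff)
    also have "\<dots> \<le> B"
      by (rule Re_circle_mean_le)
         (use r bound continuous_on_energy[OF a b] in
          \<open>auto intro!: continuous_intros intro: continuous_on_subset\<close>)
    finally show ?thesis .
  qed
  have "((\<lambda>r. \<Sum>n\<in>I. ?P n * r ^ (2 * n)) \<longlongrightarrow> (\<Sum>n\<in>I. ?P n * 1 ^ (2 * n))) (at_left (1::real))"
    by (intro tendsto_intros)
  moreover have "eventually (\<lambda>r::real. (\<Sum>n\<in>I. ?P n * r ^ (2 * n)) \<le> B) (at_left 1)"
    using eventually_at_left_real[of 0 1, OF zero_less_one] by (rule eventually_mono) (use * in auto)
  ultimately have "(\<Sum>n\<in>I. ?P n * 1 ^ (2 * n)) \<le> B"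
    by (rule tendsto_upperbound) auto
  then show ?thesis by simp
qed

text \<open>Lagrange's identity \<open>|u|\<^sup>2 |v|\<^sup>2 = |det (u, v)|\<^sup>2 + |\<langle>v, u\<rangle>|\<^sup>2\<close> in \<open>\<complex>\<^sup>2\<close>. It is the link between the
  Wronskian and the size of \<open>w'\<close>.\<close>
lemma lagrange_identity:
  fixes a0 b0 a1 b1 :: complex
  shows "((cmod a0)\<^sup>2 + (cmod b0)\<^sup>2) * ((cmod a1)\<^sup>2 + (cmod b1)\<^sup>2)
       = (cmod (a1 * b0 - a0 * b1))\<^sup>2 + (cmod (a1 * cnj a0 + b1 * cnj b0))\<^sup>2"
proof -
  have "complex_of_real (((cmod a0)\<^sup>2 + (cmod b0)\<^sup>2) * ((cmod a1)\<^sup>2 + (cmod b1)\<^sup>2))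
       = complex_of_real ((cmod (a1 * b0 - a0 * b1))\<^sup>2 + (cmod (a1 * cnj a0 + b1 * cnj b0))\<^sup>2)"
    unfolding of_real_add of_real_mult complex_norm_square by (simp add: algebra_simps)
  then show ?thesis by (simp only: of_real_eq_iff)
qed

lemma cmod_add_squared: "(cmod (x + y))\<^sup>2 = (cmod x)\<^sup>2 + 2 * Re (cnj x * y) + (cmod y)\<^sup>2"
  by (simp add: cmod_power2 power2_sum algebra_simps)

lemma has_real_derivative_cmod_squared:
  assumes "f holomorphic_on ball 0 1"
  shows "((\<lambda>x. (cmod (f (of_real x * u)))\<^sup>2) has_real_derivative 2 * Re (u * (deriv f 0 * cnj (f 0)))) (at 0)"
proof -
  have d: "(f has_field_derivative deriv f 0) (at 0)"
    using holomorphic_derivI[OF assms, of 0] by simp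
  have "((\<lambda>x. f (of_real x * u)) has_vector_derivative u * deriv f 0) (at 0)"
  proof -
    have "((\<lambda>x. complex_of_real x * u) has_vector_derivative u) (at 0)"
      by (auto intro!: derivative_eq_intros simp: has_vector_derivative_def scaleR_conv_of_real)
    then show ?thesis
      using field_vector_diff_chain_at[of "\<lambda>x. complex_of_real x * u" u 0 f "deriv f 0"] d
      by (simp add: o_def)
  qed
  then have h: "((\<lambda>x. f (of_real x * u)) has_derivative (\<lambda>x. x *\<^sub>R (u * deriv f 0))) (at 0)"
    by (simp add: has_vector_derivative_def)
  have "((\<lambda>x. f (of_real x * u) \<bullet> f (of_real x * u)) has_derivative
      (\<lambda>x. f (of_real 0 * u) \<bullet> (x *\<^sub>R (u * deriv f 0)) + (x *\<^sub>R (u * deriv f 0)) \<bullet> f (of_real 0 * u))) (at 0)"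
    using has_derivative_inner[OF h h] .
  then show ?thesis
    unfolding has_field_derivative_def power2_norm_eq_inner
    by (rule has_derivative_eq_rhs) (simp add: fun_eq_iff inner_complex_def algebra_simps)
qed

text \<open>At a minimum of \<open>|w|\<^sup>2\<close> the vectors \<open>w\<close> and \<open>w'\<close> are orthogonal, so there \<open>|w| |w'|\<close> is the modulus
  of the Wronskian. On small circles the mean of \<open>|w|\<^sup>2\<close> grows like \<open>|w'|\<^sup>2 r\<^sup>2\<close>, which the assumed
  quadratic growth bounds from below. This replaces the computation of a Laplacian.\<close>
lemma quadratic_growth_le_wronskian:
  assumes a: "a holomorphic_on ball 0 1" and b: "b holomorphic_on ball 0 1" and "0 \<le> m"
    and ge: "\<And>h. h \<in> ball 0 1 \<Longrightarrow> energy a b 0 * (1 + m * (cmod h)\<^sup>2) \<le> energy a b h"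
  shows "(energy a b 0)\<^sup>2 * m \<le> (cmod (deriv a 0 * b 0 - a 0 * deriv b 0))\<^sup>2"
proof -
  let ?P = "\<lambda>n. coeff_energy a b n"
  define E0 where "E0 = energy a b 0"
  have E0: "0 \<le> E0" "?P 0 = E0" by (simp_all add: E0_def energy_def coeff_energy_def)
  define p where "p = deriv a 0 * cnj (a 0) + deriv b 0 * cnj (b 0)"
  have Rep: "Re (u * p) = 0" if u: "cmod u = 1" for u
  proof -
    have "((\<lambda>x. energy a b (of_real x * u)) has_real_derivative 2 * Re (u * p)) (at 0)"
      unfolding energy_def p_def
      by (rule DERIV_cong[OF DERIV_add[OF has_real_derivative_cmod_squared[OF a]
            has_real_derivative_cmod_squared[OF b]]]) (simp add: algebra_simps)
    moreover have "\<forall>y. \<bar>0 - y\<bar> < 1 \<longrightarrow> energy a b (of_real 0 * u) \<le> energy a b (of_real y * u)"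
    proof (intro allI impI)
      fix y :: real assume y: "\<bar>0 - y\<bar> < 1"
      have "E0 * 1 \<le> E0 * (1 + m * (cmod (of_real y * u))\<^sup>2)"
        using E0 \<open>0 \<le> m\<close> by (intro mult_left_mono) auto
      also have "\<dots> \<le> energy a b (of_real y * u)"
        using ge[of "of_real y * u"] y u by (simp add: norm_mult E0_def)
      finally show "energy a b (of_real 0 * u) \<le> energy a b (of_real y * u)" by (simp add: E0_def)
    qed
    ultimately have "2 * Re (u * p) = 0"
      using DERIV_local_min[of "\<lambda>x. energy a b (of_real x * u)" _ 0 1] zero_less_one by blast
    then show ?thesis by simp
  qed
  have p0: "p = 0" using Rep[of 1] Rep[of \<i>] by (auto simp: complex_eq_iff)
  \<comment> \<open>Compare second order terms: divide the Parseval expansion without its constant term by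
    \<open>s = r\<^sup>2\<close> and let \<open>s\<close> tend to \<open>0\<close>.\<close>
  have "E0 * m \<le> ?P 1"
  proof -
    have "summable (\<lambda>n. ?P n * (1/2) ^ (2 * n))"
      using energy_parseval[OF a b, of "1/2"] by (auto simp: sums_iff)
    then have "summable (\<lambda>n. ?P n * (1/4) ^ n)" by (simp add: power_mult power2_eq_square)
    then have "summable (\<lambda>n. ?P (Suc n) * (1/4) ^ Suc n)" by (subst summable_Suc_iff)
    then have "summable (\<lambda>n. 4 * (?P (Suc n) * (1/4) ^ Suc n))" by (rule summable_mult)
    then have sm: "summable (\<lambda>n. ?P (Suc n) * (1/4) ^ n)" by (simp add: mult_ac)
    define Q where "Q s = suminf (\<lambda>n. ?P (Suc n) * s ^ n)" for s :: real
    have "isCont Q 0" unfolding Q_def by (rule isCont_powser[OF sm]) auto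
    moreover have "Q 0 = ?P 1" unfolding Q_def using powser_sums_zero_iff[of "\<lambda>n. ?P (Suc n)"] by (simp add: powser_zero)
    ultimately have "(Q \<longlongrightarrow> ?P 1) (at_right 0)"
      by (metis isCont_def filterlim_at_split)
    moreover have "eventually (\<lambda>s. E0 * m \<le> Q s) (at_right 0)"
    proof (rule eventually_mono)
      show "eventually (\<lambda>s::real. s \<in> {0<..<1/4}) (at_right 0)"
        by (rule eventually_at_right_real) simp
      fix s :: real assume s: "s \<in> {0<..<1/4}"
      define r where "r = sqrt s"
      have r: "0 < r" "r < 1" "r\<^sup>2 = s"
        using s by (auto simp: r_def intro: real_sqrt_lt_1_iff[THEN iffD2] )
      have S: "(\<lambda>n. ?P n * s ^ n) sums Re (circle_mean r (\<lambda>z. of_real (energy a b z)))"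
        using energy_parseval[OF a b, of r] r by (simp add: power_mult)
      have "(\<lambda>n. ?P (Suc n) * s ^ Suc n) sums (Re (circle_mean r (\<lambda>z. of_real (energy a b z))) - E0)"
        using sums_split_initial_segment[OF S, of 1] E0 by simp
      from sums_divide[OF this, of s]
      have "(\<lambda>n. ?P (Suc n) * s ^ n) sums ((Re (circle_mean r (\<lambda>z. of_real (energy a b z))) - E0) / s)"
        using s by simp
      then have Qs: "Q s = (Re (circle_mean r (\<lambda>z. of_real (energy a b z))) - E0) / s"
        by (simp add: Q_def sums_iff)
      have "Re (circle_mean r (\<lambda>z. - of_real (energy a b z))) \<le> - (E0 * (1 + m * s))"
        by (rule Re_circle_mean_le)
         (use r ge continuous_on_energy[OF a b] in
          \<open>auto intro!: continuous_intros intro: continuous_on_subset simp: E0_def\<close>)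
      then have "E0 * (1 + m * s) \<le> Re (circle_mean r (\<lambda>z. of_real (energy a b z)))"
        by (simp add: circle_mean_minus)
      then show "E0 * m \<le> Q s" unfolding Qs using s by (simp add: field_simps)
    qed
    ultimately show ?thesis by (rule tendsto_lowerbound) auto
  qed
  then have "E0 * (E0 * m) \<le> E0 * ?P 1" using E0 by (intro mult_left_mono) auto
  also have "\<dots> = (cmod (deriv a 0 * b 0 - a 0 * deriv b 0))\<^sup>2"
    using lagrange_identity[of "a 0" "b 0" "deriv a 0" "deriv b 0"] p0
    by (simp add: E0_def energy_def coeff_energy_def p_def)
  finally show ?thesis by (simp add: E0_def power2_eq_square mult_ac)
qed

lemma inscribed_disc_subset:
  assumes "z0 \<in> ball 0 1" "h \<in> ball 0 1"
  shows "z0 + of_real (1 - cmod z0) * h \<in> ball (0 :: complex) 1"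
proof -
  have r: "0 < 1 - cmod z0" using assms by simp
  have "cmod (z0 + of_real (1 - cmod z0) * h) \<le> cmod z0 + (1 - cmod z0) * cmod h"
    using norm_triangle_ineq[of z0 "of_real (1 - cmod z0) * h"] r
    by (simp add: norm_mult del: of_real_diff)
  also have "\<dots> < cmod z0 + (1 - cmod z0) * 1"
    using assms r by (intro add_strict_left_mono mult_strict_left_mono) auto
  finally show ?thesis by simp
qed

text \<open>A pair of homogeneous coordinates \<open>(a, b)\<close> for the locally injective meromorphic function \<open>a/b\<close>,
  normalised so that \<open>(a/b)' = 1/b\<^sup>2\<close>. Then \<open>N\<close>, the squared length of \<open>(a, b)\<close>, is the reciprocal of the
  spherical derivative of \<open>a/b\<close>, and \<open>P n\<close> is the squared length of the \<open>n\<close>-th Taylor coefficient.\<close>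
locale unimodular_pair =
  fixes a b :: "complex \<Rightarrow> complex"
  assumes a_holo: "a holomorphic_on ball 0 1" and b_holo: "b holomorphic_on ball 0 1"
    and wronskian: "\<And>z. z \<in> ball 0 1 \<Longrightarrow> deriv a z * b z - a z * deriv b z = 1"
begin

definition N :: "complex \<Rightarrow> real" where "N = energy a b"

definition P :: "nat \<Rightarrow> real" where "P n = (cmod (taylor a n))\<^sup>2 + (cmod (taylor b n))\<^sup>2"

lemma P_eq: "coeff_energy a b n = P n" by (simp add: coeff_energy_def P_def)

lemma P_nonneg [simp]: "0 \<le> P n" by (simp add: P_def)

lemma P_0: "P 0 = N 0" by (simp add: P_def N_def energy_def)

lemma N_pos: "z \<in> ball 0 1 \<Longrightarrow> 0 < N z"
  using wronskian[of z] unfolding N_def energy_def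
  by (metis add_pos_nonneg diff_self mult_zero_left mult_zero_right norm_eq_zero
      add_nonneg_pos zero_le_power2 zero_less_power2 zero_neq_one)

lemma continuous_on_N: "continuous_on (ball 0 1) N"
  unfolding N_def by (intro continuous_on_energy a_holo b_holo)

definition overlap :: complex where "overlap = deriv a 0 * cnj (a 0) + deriv b 0 * cnj (b 0)"

lemma P_0_mult_P_1: "N 0 * P 1 = 1 + (cmod overlap)\<^sup>2"
  using lagrange_identity[of "a 0" "b 0" "deriv a 0" "deriv b 0"] wronskian[of 0]
  by (simp add: P_def N_def energy_def overlap_def)

text \<open>The first two Taylor coefficients alone give the sharp bound: their determinant has
  modulus \<open>1\<close>, so \<open>P 0 * P 1 \<ge> 1\<close> by Lagrange's identity.\<close>
lemma interior_bound:
  assumes "\<And>z. z \<in> ball 0 1 \<Longrightarrow> N z \<le> B"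
  shows "N 0 + 1 / N 0 \<le> B"
proof -
  have "P 0 + P 1 \<le> B"
    using sum_energy_taylor_le[OF a_holo b_holo, of B "{0,1}"] assms by (simp add: P_eq N_def)
  moreover have "1 / N 0 \<le> P 1"
    using P_0_mult_P_1 N_pos[of 0] by (simp add: field_simps)
  ultimately show ?thesis by (simp add: P_0)
qed

lemma N_affine:
  assumes "\<And>n. 2 \<le> n \<Longrightarrow> P n = 0" "z \<in> ball 0 1"
  shows "N z = N 0 + 2 * Re (z * overlap) + P 1 * (cmod z)\<^sup>2"
proof -
  have t: "taylor a n = 0" "taylor b n = 0" if "2 \<le> n" for n
    using assms(1)[OF that] by (auto simp: P_def sum_power2_eq_zero_iff)
  have aff: "f z = f 0 + deriv f 0 * z" if f: "f holomorphic_on ball 0 1" "\<And>n. 2 \<le> n \<Longrightarrow> taylor f n = 0" for f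
  proof -
    have "(\<lambda>n. taylor f n * z ^ n) sums (\<Sum>n\<in>{0,1}. taylor f n * z ^ n)"
      by (rule sums_finite) (use f(2) in \<open>auto simp: not_less_eq_eq numeral_2_eq_2\<close>)
    from sums_unique2[OF taylor_sums[OF f(1) assms(2)] this] show ?thesis by simp
  qed
  have *: "(cmod (u + v * z))\<^sup>2 = (cmod u)\<^sup>2 + 2 * Re (z * (v * cnj u)) + (cmod v)\<^sup>2 * (cmod z)\<^sup>2" for u v
    by (simp only: cmod_power2 complex.sel plus_complex.sel times_complex.sel cnj.sel) algebra
  have az: "a z = a 0 + deriv a 0 * z" and bz: "b z = b 0 + deriv b 0 * z"
    by (rule aff; use a_holo b_holo t in blast)+
  show ?thesis
    unfolding N_def energy_def az bz * by (simp add: P_def overlap_def algebra_simps)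
qed

text \<open>Equality leaves no room for higher coefficients and forces the first two to be orthogonal.\<close>
lemma extremal_is_radial:
  assumes "\<And>z. z \<in> ball 0 1 \<Longrightarrow> N z \<le> B" "N 0 + 1 / N 0 = B" "z \<in> ball 0 1"
  shows "N z = N 0 + (cmod z)\<^sup>2 / N 0"
proof -
  have N0: "0 < N 0" using N_pos[of 0] by simp
  have P1: "1 / N 0 \<le> P 1"
    using P_0_mult_P_1 N0 by (simp add: field_simps)
  have P01: "P 0 + P 1 \<le> B"
    using sum_energy_taylor_le[OF a_holo b_holo, of B "{0,1}"] assms(1) by (simp add: P_eq N_def)
  then have P1': "P 1 = 1 / N 0" using P1 assms(2) by (simp add: P_0)
  then have ov: "overlap = 0" using P_0_mult_P_1 N0 by simp
  have "P n = 0" if "2 \<le> n" for n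
  proof -
    have "P 0 + P 1 + P n \<le> B"
      using sum_energy_taylor_le[OF a_holo b_holo, of B "{0,1,n}"] assms(1) that by (simp add: P_eq N_def)
    then have "P n \<le> 0" using P1' assms(2) by (simp add: P_0)
    then show ?thesis by (rule antisym) simp
  qed
  from N_affine[OF this assms(3)] show ?thesis using P1' by (simp add: ov)
qed

text \<open>An interior minimum of \<open>N z * exp (- M |z|\<^sup>2)\<close> is possible for small \<open>M\<close> only; in terms of
  \<open>u = - ln N\<close> this says that \<open>u + M |z|\<^sup>2\<close> is subharmonic once \<open>M\<close> exceeds \<open>e\<^bsup>2u\<^esup>\<close>. The linear part of
  the weight at \<open>z0\<close> is absorbed into the pair: multiplying \<open>a\<close> and \<open>b\<close> by the same zero-free holomorphic
  function \<open>l\<close> multiplies the Wronskian by \<open>l\<^sup>2\<close>, and \<open>l 0 = 1\<close>.\<close>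
lemma weighted_energy_interior_min:
  assumes z0: "z0 \<in> ball 0 1" and "0 \<le> M"
    and min: "\<And>z. z \<in> ball 0 1 \<Longrightarrow> N z0 * exp (- M * (cmod z0)\<^sup>2) \<le> N z * exp (- M * (cmod z)\<^sup>2)"
  shows "(N z0)\<^sup>2 * M \<le> 1"
proof -
  define r where "r = 1 - cmod z0"
  have r: "0 < r" using z0 by (simp add: r_def)
  have sub: "z0 + of_real r * h \<in> ball 0 1" if "h \<in> ball 0 1" for h
    unfolding r_def by (rule inscribed_disc_subset[OF z0 that])
  define l where "l h = exp (- of_real (M * r) * cnj z0 * h)" for h
  define A where "A h = a (z0 + of_real r * h) * l h" for h
  define B where "B h = b (z0 + of_real r * h) * l h" for h
  have hol: "(\<lambda>h. f (z0 + of_real r * h) * l h) holomorphic_on ball 0 1" if "f holomorphic_on ball 0 1" for f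
    unfolding l_def by (intro holomorphic_intros holomorphic_on_compose_gen[OF _ that, unfolded o_def]) (use sub in auto)
  have der: "deriv (\<lambda>h. f (z0 + of_real r * h) * l h) 0 = of_real r * deriv f z0 - f z0 * (of_real (M * r) * cnj z0)"
    if "f holomorphic_on ball 0 1" for f
  proof (rule DERIV_imp_deriv)
    have f: "(f has_field_derivative deriv f z0) (at (z0 + of_real r * 0))"
      using holomorphic_derivI[OF that _ z0] by simp
    have "((\<lambda>h. f (z0 + of_real r * h)) has_field_derivative deriv f z0 * of_real r) (at 0)"
      by (rule DERIV_chain2[where g = "\<lambda>h. z0 + of_real r * h" and x = 0, OF f])
         (auto intro!: derivative_eq_intros)
    moreover have "(l has_field_derivative - of_real (M * r) * cnj z0) (at 0)"
      unfolding l_def by (auto intro!: derivative_eq_intros)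
    ultimately show "((\<lambda>h. f (z0 + of_real r * h) * l h) has_field_derivative
        of_real r * deriv f z0 - f z0 * (of_real (M * r) * cnj z0)) (at 0)"
      by (rule DERIV_cong[OF DERIV_mult]) (simp add: l_def algebra_simps)
  qed
  have E: "energy A B h = N (z0 + of_real r * h) * exp (- 2 * M * r * Re (cnj z0 * h))" for h
    by (simp add: energy_def A_def B_def N_def l_def norm_mult power_mult_distrib algebra_simps
        exp_double[symmetric] flip: exp_of_nat_mult)
  have "(energy A B 0)\<^sup>2 * (M * r\<^sup>2) \<le> (cmod (deriv A 0 * B 0 - A 0 * deriv B 0))\<^sup>2"
  proof (rule quadratic_growth_le_wronskian)
    show "A holomorphic_on ball 0 1" "B holomorphic_on ball 0 1"
      unfolding A_def B_def by (intro hol a_holo b_holo)+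
    show "0 \<le> M * r\<^sup>2" using \<open>0 \<le> M\<close> by simp
    fix h :: complex assume h: "h \<in> ball 0 1"
    have sq: "(cmod (z0 + of_real r * h))\<^sup>2 = (cmod z0)\<^sup>2 + 2 * r * Re (cnj z0 * h) + r\<^sup>2 * (cmod h)\<^sup>2"
    proof -
      have "cnj z0 * (of_real r * h) = of_real r * (cnj z0 * h)" by simp
      then show ?thesis
        unfolding cmod_add_squared
        by (simp only: norm_mult power_mult_distrib norm_of_real power2_abs Re_complex_of_real
              times_complex.sel Im_complex_of_real) simp
    qed
    have "N z0 * (1 + M * r\<^sup>2 * (cmod h)\<^sup>2) \<le> N z0 * exp (M * r\<^sup>2 * (cmod h)\<^sup>2)"
      using N_pos[OF z0] by (intro mult_left_mono exp_ge_add_one_self) auto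
    also have "\<dots> = (N z0 * exp (- M * (cmod z0)\<^sup>2)) * exp (M * (cmod z0)\<^sup>2 + M * r\<^sup>2 * (cmod h)\<^sup>2)"
      unfolding mult.assoc exp_add[symmetric] by simp
    also have "\<dots> \<le> (N (z0 + of_real r * h) * exp (- M * (cmod (z0 + of_real r * h))\<^sup>2)) * exp (M * (cmod z0)\<^sup>2 + M * r\<^sup>2 * (cmod h)\<^sup>2)"
      by (intro mult_right_mono min sub h) auto
    also have "\<dots> = energy A B h"
      unfolding E sq mult.assoc exp_add[symmetric] by (simp add: algebra_simps)
    finally show "energy A B 0 * (1 + M * r\<^sup>2 * (cmod h)\<^sup>2) \<le> energy A B h" by (simp add: E)
  qed
  moreover have "deriv A 0 * B 0 - A 0 * deriv B 0 = of_real r"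
  proof -
    have "deriv A 0 * B 0 - A 0 * deriv B 0 = of_real r * (deriv a z0 * b z0 - a z0 * deriv b z0)"
      unfolding A_def B_def der[OF a_holo] der[OF b_holo] by (simp add: l_def algebra_simps)
    then show ?thesis using wronskian[OF z0] by simp
  qed
  ultimately have "(N z0)\<^sup>2 * M * r\<^sup>2 \<le> 1 * r\<^sup>2" by (simp add: E mult_ac)
  then show ?thesis using r by (simp only: mult_le_cancel_right_pos zero_less_power)
qed

text \<open>Maximum principle: for large \<open>M\<close> the minimum of \<open>N z * exp (- M |z|\<^sup>2)\<close> over the closed disc, where
  \<open>N\<close> is extended by its boundary value \<open>B\<close>, lies on the boundary. Comparing with that value gives
  linear decay of \<open>B - N\<close>.\<close>
lemma boundary_decay:
  assumes lim: "\<And>\<xi>. \<xi> \<in> sphere 0 1 \<Longrightarrow> (N \<longlongrightarrow> B) (at \<xi> within ball 0 1)" and B: "0 < B"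
  obtains m C where "0 < m" "\<And>z. z \<in> ball 0 1 \<Longrightarrow> m \<le> N z" "0 \<le> C"
    "\<And>z. z \<in> ball 0 1 \<Longrightarrow> B - N z \<le> C * (1 - cmod z)"
proof -
  define E where "E z = (if z \<in> ball 0 1 then N z else B)" for z
  have cE: "continuous_on (cball 0 1) E"
    unfolding continuous_on
  proof
    fix x :: complex assume x: "x \<in> cball 0 1"
    have eb: "\<forall>\<^sub>F z in at x within ball 0 1. N z = E z"
      by (auto simp: E_def eventually_at_filter)
    show "(E \<longlongrightarrow> E x) (at x within cball 0 1)"
    proof (cases "x \<in> ball 0 1")
      case True
      have "(N \<longlongrightarrow> N x) (at x within ball 0 1)"
        using continuous_on_N True by (auto simp: continuous_on)
      then have "(E \<longlongrightarrow> N x) (at x within ball 0 1)"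
        by (rule iffD1[OF tendsto_cong[OF eb]])
      then have "(E \<longlongrightarrow> E x) (at x within ball 0 1)"
        using True by (simp add: E_def[of x])
      moreover have "at x within cball 0 1 = at x within ball 0 1"
        using True at_within_interior[of x "cball 0 1"] at_within_open[of x "ball 0 1"] by (simp add: interior_cball)
      ultimately show ?thesis by simp
    next
      case False
      then have xs: "x \<in> sphere 0 1" using x by auto
      have "(E \<longlongrightarrow> B) (at x within ball 0 1)"
        by (rule iffD1[OF tendsto_cong[OF eb] lim[OF xs]])
      then have "(E \<longlongrightarrow> E x) (at x within ball 0 1)"
        using False by (simp add: E_def[of x])
      moreover have "(E \<longlongrightarrow> E x) (at x within sphere 0 1)"
      proof (rule tendsto_eventually)
        show "\<forall>\<^sub>F z in at x within sphere 0 1. E z = E x"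
          using False by (auto simp: E_def eventually_at_filter)
      qed
      ultimately have "(E \<longlongrightarrow> E x) (at x within (ball 0 1 \<union> sphere 0 1))"
        by (rule Lim_Un)
      moreover have "cball 0 1 = ball 0 1 \<union> sphere (0 :: complex) 1" by auto
      ultimately show ?thesis by (simp only:)
    qed
  qed
  have ne: "cball 0 1 \<noteq> ({} :: complex set)" by simp
  obtain x0 where x0: "x0 \<in> cball 0 1" "\<And>z. z \<in> cball 0 1 \<Longrightarrow> E x0 \<le> E z"
    using continuous_attains_inf[OF compact_cball ne cE] by blast
  define m where "m = E x0"
  have m: "0 < m" using N_pos[of x0] B by (simp add: m_def E_def)
  have mN: "m \<le> N z" if "z \<in> ball 0 1" for z using x0(2)[of z] that by (simp add: m_def E_def)
  define M where "M = 1 / m\<^sup>2 + 1"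
  have M: "0 \<le> M" by (simp add: M_def)
  have cg: "continuous_on (cball 0 1) (\<lambda>z. E z * exp (- M * (cmod z)\<^sup>2))"
    by (intro continuous_intros cE)
  obtain z0 where z0: "z0 \<in> cball 0 1"
     "\<And>z. z \<in> cball 0 1 \<Longrightarrow> E z0 * exp (- M * (cmod z0)\<^sup>2) \<le> E z * exp (- M * (cmod z)\<^sup>2)"
    using continuous_attains_inf[OF compact_cball ne cg] by blast
  have "z0 \<notin> ball 0 1"
  proof
    assume z0b: "z0 \<in> ball 0 1"
    have "(N z0)\<^sup>2 * M \<le> 1"
    proof (rule weighted_energy_interior_min[OF z0b M])
      fix z :: complex assume "z \<in> ball 0 1"
      then show "N z0 * exp (- M * (cmod z0)\<^sup>2) \<le> N z * exp (- M * (cmod z)\<^sup>2)"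
        using z0(2)[of z] z0b by (simp add: E_def)
    qed
    moreover have "m\<^sup>2 * M \<le> (N z0)\<^sup>2 * M"
      using mN[OF z0b] m M by (intro mult_right_mono power_mono) auto
    ultimately have "m\<^sup>2 * M \<le> 1" by simp
    then show False using m by (simp add: M_def field_simps)
  qed
  then have z0s: "cmod z0 = 1" using z0 by simp
  have "B - N z \<le> 2 * B * M * (1 - cmod z)" if z: "z \<in> ball 0 1" for z
  proof -
    have "B * exp (- M) \<le> N z * exp (- M * (cmod z)\<^sup>2)"
      using z0(2)[of z] z z0s by (simp add: E_def)
    then have "B * exp (- M) * exp (M * (cmod z)\<^sup>2) \<le> N z * exp (- M * (cmod z)\<^sup>2) * exp (M * (cmod z)\<^sup>2)"
      by (intro mult_right_mono) auto
    then have "B * exp (- M * (1 - (cmod z)\<^sup>2)) \<le> N z"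
      by (simp add: mult.assoc exp_add[symmetric] algebra_simps)
    moreover have "B * (1 + (- M * (1 - (cmod z)\<^sup>2))) \<le> B * exp (- M * (1 - (cmod z)\<^sup>2))"
      using B by (intro mult_left_mono exp_ge_add_one_self) auto
    ultimately have "B - N z \<le> B * M * (1 - (cmod z)\<^sup>2)" by (simp add: algebra_simps)
    also have "\<dots> = B * M * ((1 + cmod z) * (1 - cmod z))" by (simp add: power2_eq_square algebra_simps)
    also have "\<dots> \<le> B * M * (2 * (1 - cmod z))"
      using B M z by (intro mult_left_mono mult_right_mono) auto
    finally show ?thesis by (simp add: mult.assoc mult.left_commute)
  qed
  moreover have "0 \<le> 2 * B * M" using B M by simp
  ultimately show ?thesis using that m mN by blast
qed

end

section \<open>Constant boundary values force affine pairs\<close>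

lemma taylor_second_deriv:
  "taylor (deriv (deriv f)) n = of_nat ((n + 2) * (n + 1)) * taylor f (n + 2)"
proof -
  have "(deriv ^^ n) (deriv (deriv f)) = (deriv ^^ (n + 2)) f"
    by (simp add: funpow_swap1)
  moreover have "(fact (n + 2) :: complex) = of_nat ((n + 2) * (n + 1)) * fact n"
    by (simp add: algebra_simps)
  ultimately show ?thesis
    by (simp add: taylor_def del: of_nat_mult of_nat_add funpow.simps fact_Suc add_2_eq_Suc')
qed

lemma square_second_deriv_sums:
  assumes f: "f holomorphic_on ball 0 1" and z: "z \<in> ball 0 1"
  shows "(\<lambda>n. of_nat (n * (n - 1)) * taylor f n * z ^ n) sums (z\<^sup>2 * deriv (deriv f) z)"
proof -
  have "deriv (deriv f) holomorphic_on ball 0 1"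
    by (intro holomorphic_deriv f) auto
  from sums_mult[OF taylor_sums[OF this z], of "z\<^sup>2"]
  have "(\<lambda>n. of_nat ((n + 2) * (n + 2 - 1)) * taylor f (n + 2) * z ^ (n + 2)) sums (z\<^sup>2 * deriv (deriv f) z)"
    by (simp add: taylor_second_deriv power_add mult_ac power2_eq_square)
  then show ?thesis
    using sums_iff_shift[of "\<lambda>n. of_nat (n * (n - 1)) * taylor f n * z ^ n" 2] by (simp add: eval_nat_numeral)
qed

text \<open>Each of the powers \<open>r\<^sup>0, \<dots>, r\<^sup>n\<close> is at least \<open>r\<^sup>n\<close>, and their sum is at most \<open>1 / (1 - r)\<close>.\<close>
lemma Suc_mult_power_le:
  fixes r :: real
  assumes "0 \<le> r" "r < 1"
  shows "real (Suc n) * r ^ n * (1 - r) \<le> 1"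
proof -
  have "real (Suc n) * r ^ n = (\<Sum>k\<le>n. r ^ n)" by simp
  also have "\<dots> \<le> (\<Sum>k\<le>n. r ^ k)"
    by (rule sum_mono) (use assms in \<open>auto intro: power_decreasing\<close>)
  finally have "real (Suc n) * r ^ n * (1 - r) \<le> (\<Sum>k\<le>n. r ^ k) * (1 - r)"
    using assms by (intro mult_right_mono) auto
  also have "\<dots> = 1 - r ^ Suc n"
    using one_diff_power_eq[of r "Suc n"] by (simp add: lessThan_Suc_atMost mult.commute del: power_Suc)
  also have "\<dots> \<le> 1" using assms by simp
  finally show ?thesis .
qed

context unimodular_pair
begin

text \<open>Half the Schwarzian derivative of \<open>a/b\<close>; it is the potential of the linear equation that both \<open>a\<close>
  and \<open>b\<close> solve.\<close>
definition q :: "complex \<Rightarrow> complex" where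
  "q z = deriv (deriv a) z * deriv b z - deriv a z * deriv (deriv b) z"

lemma q_holo: "q holomorphic_on ball 0 1"
  unfolding q_def by (intro holomorphic_intros holomorphic_deriv a_holo b_holo open_ball)

text \<open>Differentiating the Wronskian gives \<open>a'' b = a b''\<close>.\<close>
lemma
  assumes z: "z \<in> ball 0 1"
  shows ode_a: "deriv (deriv a) z = - q z * a z" and ode_b: "deriv (deriv b) z = - q z * b z"
proof -
  have D: "(f has_field_derivative deriv f z) (at z)" if "f holomorphic_on ball 0 1" for f
    using holomorphic_derivI[OF that _ z] by simp
  note Da = D[OF a_holo] and Db = D[OF b_holo]
  have Da': "(deriv a has_field_derivative deriv (deriv a) z) (at z)"
    and Db': "(deriv b has_field_derivative deriv (deriv b) z) (at z)"
    by (intro D holomorphic_deriv a_holo b_holo open_ball)+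
  have "((\<lambda>z. deriv a z * b z - a z * deriv b z) has_field_derivative
        deriv (deriv a) z * b z - a z * deriv (deriv b) z) (at z)"
    by (rule DERIV_cong[OF DERIV_diff[OF DERIV_mult[OF Da' Db] DERIV_mult[OF Da Db']]])
       (simp add: algebra_simps)
  moreover have "((\<lambda>z. deriv a z * b z - a z * deriv b z) has_field_derivative 0) (at z)"
    by (rule has_field_derivative_transform_within_open[of "\<lambda>_. 1" _ _ "ball 0 1"])
       (use z wronskian in auto)
  ultimately have e: "deriv (deriv a) z * b z - a z * deriv (deriv b) z = 0"
    by (rule DERIV_unique)
  have w: "deriv a z * b z - a z * deriv b z = 1" by (rule wronskian[OF z])
  show "deriv (deriv a) z = - q z * a z" using e w unfolding q_def by algebra
  show "deriv (deriv b) z = - q z * b z" using e w unfolding q_def by algebra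
qed

lemma energy_second_deriv:
  "z \<in> ball 0 1 \<Longrightarrow> energy (deriv (deriv a)) (deriv (deriv b)) z = (cmod (q z))\<^sup>2 * N z"
  by (simp add: energy_def N_def ode_a ode_b norm_mult power_mult_distrib algebra_simps)

text \<open>Near \<open>z\<^sub>0\<close> the scalar product of \<open>w\<close> with the fixed vector \<open>w(z\<^sub>0)\<close> has real part at most
  \<open>(N z + N z\<^sub>0) / 2 \<le> (B + N z\<^sub>0) / 2\<close>, so the difference \<open>p\<close> is a function of nonnegative real part on the
  largest disc about \<open>z\<^sub>0\<close>. Its second derivative there is a multiple of \<open>q z\<^sub>0 * N z\<^sub>0\<close>, and its value is
  \<open>(B - N z\<^sub>0) / 2\<close>: the closer \<open>N z\<^sub>0\<close> is to \<open>B\<close>, the smaller is \<open>q z\<^sub>0\<close>.\<close>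
lemma q_bound:
  assumes bound: "\<And>z. z \<in> ball 0 1 \<Longrightarrow> N z \<le> B" and z0: "z0 \<in> ball 0 1"
  shows "cmod (q z0) * N z0 * (1 - cmod z0)\<^sup>2 \<le> 2 * (B - N z0)"
proof -
  define r where "r = 1 - cmod z0"
  have r: "0 < r" using z0 by (simp add: r_def)
  have sub: "z0 + of_real r * h \<in> ball 0 1" if "h \<in> ball 0 1" for h
    unfolding r_def by (rule inscribed_disc_subset[OF z0 that])
  define p where "p h = of_real ((N z0 + B) / 2) -
      (a (z0 + of_real r * h) * cnj (a z0) + b (z0 + of_real r * h) * cnj (b z0))" for h
  have hol: "(\<lambda>h. f (z0 + of_real r * h)) holomorphic_on ball 0 1" if "f holomorphic_on ball 0 1" for f
    by (intro holomorphic_on_compose_gen[OF _ that, unfolded o_def] holomorphic_intros) (use sub in auto)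
  have D: "((\<lambda>h. f (z0 + of_real r * h)) has_field_derivative of_real r * deriv f (z0 + of_real r * h)) (at h)"
    if "f holomorphic_on ball 0 1" "h \<in> ball 0 1" for f h
  proof -
    have f: "(f has_field_derivative deriv f (z0 + of_real r * h)) (at (z0 + of_real r * h))"
      using holomorphic_derivI[OF that(1) _ sub[OF that(2)]] by simp
    show ?thesis
      by (rule DERIV_cong[OF DERIV_chain2[where g = "\<lambda>h. z0 + of_real r * h" and x = h, OF f]])
         (auto intro!: derivative_eq_intros)
  qed
  have p_holo: "p holomorphic_on ball 0 1"
    unfolding p_def by (intro holomorphic_intros hol a_holo b_holo)
  have p_pos: "0 \<le> Re (p h)" if h: "h \<in> ball 0 1" for h
  proof -
    let ?z = "z0 + of_real r * h"
    have "0 \<le> (Re (a ?z) - Re (a z0))\<^sup>2 + (Im (a ?z) - Im (a z0))\<^sup>2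
            + (Re (b ?z) - Re (b z0))\<^sup>2 + (Im (b ?z) - Im (b z0))\<^sup>2" by simp
    also have "\<dots> = N ?z + N z0 - 2 * Re (a ?z * cnj (a z0) + b ?z * cnj (b z0))"
      by (simp add: N_def energy_def cmod_power2 power2_diff algebra_simps)
    finally show ?thesis using bound[OF sub[OF h]] by (simp add: p_def)
  qed
  have p1: "deriv p h = - (of_real r * deriv a (z0 + of_real r * h) * cnj (a z0)
      + of_real r * deriv b (z0 + of_real r * h) * cnj (b z0))" if "h \<in> ball 0 1" for h
    by (rule DERIV_imp_deriv)
       (use that in \<open>auto simp: p_def[abs_def] intro!: derivative_eq_intros D a_holo b_holo\<close>)
  have p2: "deriv (deriv p) 0 = - (of_real (r\<^sup>2) * (deriv (deriv a) z0 * cnj (a z0) + deriv (deriv b) z0 * cnj (b z0)))"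
  proof (rule DERIV_imp_deriv, rule has_field_derivative_transform_within_open)
    have "((\<lambda>h. - (of_real r * deriv a (z0 + of_real r * h) * cnj (a z0)
      + of_real r * deriv b (z0 + of_real r * h) * cnj (b z0))) has_field_derivative
      - (of_real r * (of_real r * deriv (deriv a) (z0 + of_real r * 0)) * cnj (a z0)
       + of_real r * (of_real r * deriv (deriv b) (z0 + of_real r * 0)) * cnj (b z0))) (at 0)"
      by (intro derivative_intros DERIV_cmult_right DERIV_cmult D holomorphic_deriv a_holo b_holo open_ball) auto
    then show "((\<lambda>h. - (of_real r * deriv a (z0 + of_real r * h) * cnj (a z0)
      + of_real r * deriv b (z0 + of_real r * h) * cnj (b z0))) has_field_derivative
      - (of_real (r\<^sup>2) * (deriv (deriv a) z0 * cnj (a z0) + deriv (deriv b) z0 * cnj (b z0)))) (at 0)"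
      by (rule DERIV_cong) (simp add: power2_eq_square algebra_simps)
  qed (use p1 in \<open>auto intro: open_ball[of 0 1]\<close>)
  have "a z0 * cnj (a z0) + b z0 * cnj (b z0) = of_real (N z0)"
    by (simp only: N_def energy_def complex_norm_square of_real_add)
  moreover have "deriv (deriv p) 0 = of_real (r\<^sup>2) * (q z0 * (a z0 * cnj (a z0) + b z0 * cnj (b z0)))"
    unfolding p2 ode_a[OF z0] ode_b[OF z0] by (simp add: algebra_simps)
  ultimately have "cmod (deriv (deriv p) 0) = cmod (q z0) * N z0 * r\<^sup>2"
    using N_pos[OF z0] by (simp add: norm_mult norm_power)
  moreover have "Re (p 0) = (B - N z0) / 2"
  proof -
    have "p 0 = of_real ((N z0 + B) / 2) - of_real (N z0)"
      by (simp only: p_def N_def energy_def complex_norm_square of_real_add mult_zero_right add_0_right)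
    also have "\<dots> = of_real ((B - N z0) / 2)" by (simp add: field_simps)
    finally show ?thesis by (simp only: Re_complex_of_real)
  qed
  ultimately show ?thesis using caratheodory_second_derivative[OF p_holo p_pos] by (simp add: r_def)
qed

text \<open>Both sides are the mean of \<open>\<langle>z\<^sup>2 w'', w\<rangle>\<close>: on the left by Parseval, on the right by \<open>w'' = - q w\<close>,
  where the constant \<open>B\<close> may be inserted since \<open>z\<^sup>2 q\<close> is holomorphic and vanishes at \<open>0\<close>.\<close>
lemma pohozaev:
  assumes r: "0 \<le> r" "r < 1"
  shows "(\<lambda>n. real (n * (n - 1)) * P n * r ^ (2 * n)) sums
           Re (circle_mean r (\<lambda>z. z\<^sup>2 * q z * of_real (B - N z)))"
proof -
  have cont: "continuous_on (sphere 0 r) f" if "f holomorphic_on ball 0 1" for f :: "complex \<Rightarrow> complex"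
    using holomorphic_on_imp_continuous_on[OF that] r by (auto elim!: continuous_on_subset)
  have cN: "continuous_on (sphere 0 r) N"
    using continuous_on_N r by (auto elim!: continuous_on_subset)
  note cts = cont[OF a_holo] cont[OF b_holo] cont[OF q_holo] cN
     cont[OF holomorphic_deriv[OF holomorphic_deriv[OF a_holo open_ball] open_ball]]
     cont[OF holomorphic_deriv[OF holomorphic_deriv[OF b_holo open_ball] open_ball]]
  have "(\<lambda>n. of_nat (n * (n - 1)) * taylor a n * cnj (taylor a n) * of_real (r ^ (2 * n))
           + of_nat (n * (n - 1)) * taylor b n * cnj (taylor b n) * of_real (r ^ (2 * n)))
     sums (circle_mean r (\<lambda>z. z\<^sup>2 * deriv (deriv a) z * cnj (a z)) + circle_mean r (\<lambda>z. z\<^sup>2 * deriv (deriv b) z * cnj (b z)))"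
    by (intro sums_add parseval_powser square_second_deriv_sums taylor_sums a_holo b_holo r)
  also have "circle_mean r (\<lambda>z. z\<^sup>2 * deriv (deriv a) z * cnj (a z)) + circle_mean r (\<lambda>z. z\<^sup>2 * deriv (deriv b) z * cnj (b z))
     = circle_mean r (\<lambda>z. z\<^sup>2 * deriv (deriv a) z * cnj (a z) + z\<^sup>2 * deriv (deriv b) z * cnj (b z))"
    by (rule circle_mean_add[symmetric]) (use r cts in \<open>auto intro!: continuous_intros\<close>)
  also have "\<dots> = circle_mean r (\<lambda>z. z\<^sup>2 * q z * of_real (B - N z) + (- of_real B) * (z\<^sup>2 * q z))"
  proof (rule circle_mean_cong)
    fix z assume "cmod z = r"
    then have z: "z \<in> ball 0 1" using r by simp
    show "z\<^sup>2 * deriv (deriv a) z * cnj (a z) + z\<^sup>2 * deriv (deriv b) z * cnj (b z)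
       = z\<^sup>2 * q z * of_real (B - N z) + (- of_real B) * (z\<^sup>2 * q z)"
      by (simp add: ode_a[OF z] ode_b[OF z] N_def energy_def complex_norm_square algebra_simps
            del: of_real_power)
  qed (use r in auto)
  also have "\<dots> = circle_mean r (\<lambda>z. z\<^sup>2 * q z * of_real (B - N z)) + circle_mean r (\<lambda>z. (- of_real B) * (z\<^sup>2 * q z))"
    by (rule circle_mean_add) (use r cts in \<open>auto intro!: continuous_intros\<close>)
  also have "circle_mean r (\<lambda>z. (- of_real B) * (z\<^sup>2 * q z)) = 0"
    unfolding circle_mean_cmult
    by (subst circle_mean_holomorphic) (use r in \<open>auto intro!: holomorphic_intros q_holo\<close>)
  finally have "(\<lambda>n. Re (of_nat (n * (n - 1)) * taylor a n * cnj (taylor a n) * of_real (r ^ (2 * n))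
           + of_nat (n * (n - 1)) * taylor b n * cnj (taylor b n) * of_real (r ^ (2 * n))))
     sums Re (circle_mean r (\<lambda>z. z\<^sup>2 * q z * of_real (B - N z)))"
    by (intro sums_Re) simp
  moreover have "Re (of_nat (n * (n - 1)) * taylor a n * cnj (taylor a n) * of_real (r ^ (2 * n))
           + of_nat (n * (n - 1)) * taylor b n * cnj (taylor b n) * of_real (r ^ (2 * n)))
        = real (n * (n - 1)) * P n * r ^ (2 * n)" for n
  proof -
    have "of_nat (n * (n - 1)) * taylor a n * cnj (taylor a n) * of_real (r ^ (2 * n))
           + of_nat (n * (n - 1)) * taylor b n * cnj (taylor b n) * of_real (r ^ (2 * n))
        = of_real (real (n * (n - 1)) * P n * r ^ (2 * n))"
      unfolding of_real_mult of_real_add P_def complex_norm_square of_real_of_nat_eq by (simp add: algebra_simps)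
    then show ?thesis by (simp only: Re_complex_of_real)
  qed
  ultimately show ?thesis by simp
qed

text \<open>The Pohozaev sum \<open>S r = \<Sum>n (n-1) P n r\<^bsup>2n\<^esup>\<close> is shown to tend to \<open>0\<close> as \<open>r \<rightarrow> 1\<close>, in two steps.
  Pointwise, \<open>|q| = O(1 / (1 - r))\<close> and \<open>B - N = O(1 - r)\<close>, so \<open>S\<close> is bounded and \<open>n (n-1) P n\<close> is
  summable. In quadratic mean this improves the bound of \<open>q\<close>: since \<open>|q|\<^sup>2 N = |w''|\<^sup>2\<close>, Parseval for \<open>w''\<close>
  and dominated convergence show that \<open>(1 - r)\<^sup>2\<close> times the mean of \<open>|q|\<^sup>2\<close> tends to \<open>0\<close>.\<close>
lemma constant_boundary_values_imp_affine:
  assumes bound: "\<And>z. z \<in> ball 0 1 \<Longrightarrow> N z \<le> B"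
    and lim: "\<And>\<xi>. \<xi> \<in> sphere 0 1 \<Longrightarrow> (N \<longlongrightarrow> B) (at \<xi> within ball 0 1)" and n: "2 \<le> n"
  shows "P n = 0"
proof -
  have B: "0 < B" using N_pos[of 0] bound[of 0] by simp
  obtain m C where m: "0 < m" "\<And>z. z \<in> ball 0 1 \<Longrightarrow> m \<le> N z" and C: "0 \<le> C"
    "\<And>z. z \<in> ball 0 1 \<Longrightarrow> B - N z \<le> C * (1 - cmod z)"
    using boundary_decay[OF lim B] by metis
  have qd: "cmod (q z) * (1 - cmod z) \<le> 2 * C / m" if z: "z \<in> ball 0 1" for z
  proof -
    have d: "0 < 1 - cmod z" using z by simp
    have "cmod (q z) * m * (1 - cmod z)\<^sup>2 \<le> cmod (q z) * N z * (1 - cmod z)\<^sup>2"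
      by (intro mult_right_mono mult_left_mono m z) auto
    also have "\<dots> \<le> 2 * (C * (1 - cmod z))" using q_bound[OF bound z] C(2)[OF z] by simp
    finally have "(cmod (q z) * m * (1 - cmod z)) * (1 - cmod z) \<le> (2 * C) * (1 - cmod z)"
      by (simp add: power2_eq_square algebra_simps)
    then have "cmod (q z) * m * (1 - cmod z) \<le> 2 * C" using d by (simp only: mult_le_cancel_right_pos)
    then show ?thesis using m by (simp add: field_simps)
  qed
  define S where "S r = Re (circle_mean r (\<lambda>z. z\<^sup>2 * q z * of_real (B - N z)))" for r
  have Ssum: "(\<lambda>n. real (n * (n - 1)) * P n * r ^ (2 * n)) sums S r" if "0 < r" "r < 1" for r
    unfolding S_def using pohozaev that by simp
  have cont: "continuous_on (sphere 0 r) (\<lambda>z. z\<^sup>2 * q z * of_real (B - N z))"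
    if "0 < r" "r < 1" for r
    using holomorphic_on_imp_continuous_on[OF q_holo] continuous_on_N that
    by (auto intro!: continuous_intros elim!: continuous_on_subset)
  have pt: "cmod (z\<^sup>2 * q z * of_real (B - N z)) \<le> C * (cmod (q z) * (1 - cmod z))" if z: "z \<in> ball 0 1" for z
  proof -
    have "cmod (z\<^sup>2 * q z * of_real (B - N z)) = (cmod z)\<^sup>2 * (cmod (q z) * (B - N z))"
      using bound[OF z] by (simp add: norm_mult norm_power del: of_real_diff)
    also have "\<dots> \<le> 1 * (cmod (q z) * (C * (1 - cmod z)))"
      using z bound[OF z] C(2)[OF z] by (intro mult_mono mult_left_mono) (auto simp: power_le_one)
    finally show ?thesis by (simp add: mult_ac)
  qed
  define K where "K = 2 * C\<^sup>2 / m"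
  have S_le: "S r \<le> K" if r: "0 < r" "r < 1" for r
  proof -
    have "cmod (circle_mean r (\<lambda>z. z\<^sup>2 * q z * of_real (B - N z))) \<le> Re (circle_mean r (\<lambda>z. of_real K))"
    proof (rule norm_circle_mean_le)
      fix z assume "cmod z = r"
      then have z: "z \<in> ball 0 1" using r by simp
      have "C * (cmod (q z) * (1 - cmod z)) \<le> C * (2 * C / m)"
        by (intro mult_left_mono qd z C)
      then show "cmod (z\<^sup>2 * q z * of_real (B - N z)) \<le> Re (of_real K)"
        using pt[OF z] by (simp add: K_def power2_eq_square mult_ac)
    qed (use cont r in auto)
    also have "\<dots> = K" by (simp add: circle_mean_def)
    finally show ?thesis unfolding S_def using complex_Re_le_cmod order_trans by blast
  qed
  \<comment> \<open>The coefficients of the Pohozaev sum, re-indexed to start at its first nonzero term \<open>n = 2\<close>.\<close>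
  define c where "c n = real ((n + 2) * (n + 1)) * P (n + 2)" for n
  have c0: "0 \<le> c n" for n by (simp add: c_def)
  have cS: "(\<lambda>n. c n * r ^ (2 * n + 4)) sums S r" if r: "0 < r" "r < 1" for r
  proof -
    have "(\<lambda>n. real ((n + 2) * (n + 2 - 1)) * P (n + 2) * r ^ (2 * (n + 2))) sums S r"
      using Ssum[OF r] sums_iff_shift[of "\<lambda>n. real (n * (n - 1)) * P n * r ^ (2 * n)" 2] by (simp add: eval_nat_numeral)
    moreover have "2 * (n + 2) = 2 * n + 4" "n + 2 - 1 = n + 1" for n :: nat by simp_all
    ultimately show ?thesis unfolding c_def by (simp only:)
  qed
  have sum_c: "summable c"
  proof (rule bounded_imp_summable)
    show "0 \<le> c n" for n by (rule c0)
    fix k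
    have "((\<lambda>r. \<Sum>n\<le>k. c n * r ^ (2 * n + 4)) \<longlongrightarrow> (\<Sum>n\<le>k. c n * 1 ^ (2 * n + 4))) (at_left (1::real))"
      by (intro tendsto_intros)
    moreover have "eventually (\<lambda>r::real. (\<Sum>n\<le>k. c n * r ^ (2 * n + 4)) \<le> K) (at_left 1)"
      using eventually_at_left_real[of 0 1, OF zero_less_one]
    proof (rule eventually_mono)
      fix r :: real assume r: "r \<in> {0<..<1}"
      have "(\<Sum>n\<le>k. c n * r ^ (2 * n + 4)) \<le> suminf (\<lambda>n. c n * r ^ (2 * n + 4))"
        by (rule sum_le_suminf) (use cS[of r] r c0 in \<open>auto simp: sums_iff\<close>)
      also have "\<dots> = S r" using cS[of r] r by (simp add: sums_iff)
      also have "\<dots> \<le> K" using S_le r by simp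
      finally show "(\<Sum>n\<le>k. c n * r ^ (2 * n + 4)) \<le> K" .
    qed
    ultimately have "(\<Sum>n\<le>k. c n * 1 ^ (2 * n + 4)) \<le> K" by (rule tendsto_upperbound) auto
    then show "(\<Sum>n\<le>k. c n) \<le> K" by simp
  qed
  \<comment> \<open>\<open>(1 - r)\<^sup>2\<close> times the mean of \<open>|w''|\<^sup>2\<close>. Its \<open>n\<close>-th term tends to \<open>0\<close> and is at most \<open>2 * c n\<close>.\<close>
  define X where "X r = (1 - r)\<^sup>2 * Re (circle_mean r (\<lambda>z. of_real (energy (deriv (deriv a)) (deriv (deriv b)) z)))" for r
  have Xsum: "(\<lambda>n. (1 - r)\<^sup>2 * (real ((n + 2) * (n + 1)) * c n * r ^ (2 * n))) sums X r" if r: "0 < r" "r < 1" for r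
  proof -
    have "(\<lambda>n. coeff_energy (deriv (deriv a)) (deriv (deriv b)) n * r ^ (2 * n)) sums
       Re (circle_mean r (\<lambda>z. of_real (energy (deriv (deriv a)) (deriv (deriv b)) z)))"
      by (rule energy_parseval) (use r in \<open>auto intro!: holomorphic_deriv a_holo b_holo\<close>)
    moreover have "coeff_energy (deriv (deriv a)) (deriv (deriv b)) n = real ((n + 2) * (n + 1)) * c n" for n
      unfolding coeff_energy_def taylor_second_deriv norm_mult norm_of_nat power_mult_distrib c_def P_def power2_eq_square
      by (simp only: algebra_simps)
    ultimately show ?thesis unfolding X_def by (intro sums_mult) simp
  qed
  have X0: "(X \<longlongrightarrow> 0) (at_left 1)"
  proof -
    let ?f = "\<lambda>n r::real. (1 - r)\<^sup>2 * (real ((n + 2) * (n + 1)) * c n * r ^ (2 * n))"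
    have "((\<lambda>r. suminf (\<lambda>n. ?f n r)) \<longlongrightarrow> suminf (\<lambda>n. 0)) (at_left 1)"
    proof (rule tannerys_theorem[THEN conjunct2, THEN conjunct2])
      fix k
      have "(?f k \<longlongrightarrow> (1 - 1)\<^sup>2 * (real ((k + 2) * (k + 1)) * c k * 1 ^ (2 * k))) (at_left 1)"
        by (intro tendsto_intros)
      then show "(?f k \<longlongrightarrow> 0) (at_left 1)" by simp
    next
      have "\<forall>\<^sub>F r::real in at_left 1. \<forall>k. norm (?f k r) \<le> 2 * c k"
        using eventually_at_left_real[of 0 1, OF zero_less_one]
      proof (rule eventually_mono, intro allI)
        fix r :: real and k assume r: "r \<in> {0<..<1}"
        let ?u = "real (Suc k) * r ^ k * (1 - r)"
        have u: "?u \<le> 1" "0 \<le> ?u" using Suc_mult_power_le[of r k] r by auto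
        have "?f k r \<le> 2 * c k * (?u * ?u)"
        proof -
          have p: "r ^ (2 * k) = (r ^ k)\<^sup>2" by (simp add: power_mult[symmetric] mult.commute)
          have "?f k r = real (k + 2) * (real (Suc k) * ((r ^ k)\<^sup>2 * (1 - r)\<^sup>2 * c k))"
            unfolding p by (simp only: of_nat_mult Suc_eq_plus1 mult_ac)
          also have "\<dots> \<le> 2 * real (Suc k) * (real (Suc k) * ((r ^ k)\<^sup>2 * (1 - r)\<^sup>2 * c k))"
            by (rule mult_right_mono) (simp_all add: c0)
          also have "\<dots> = 2 * c k * (?u * ?u)" by (simp only: power2_eq_square mult_ac)
          finally show ?thesis .
        qed
        also have "\<dots> \<le> 2 * c k * (1 * 1)"
          by (intro mult_left_mono mult_mono u) (use c0 u in auto)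
        finally show "norm (?f k r) \<le> 2 * c k" using c0[of k] r by simp
      qed
      then show "\<forall>\<^sub>F (k, r) in at_top \<times>\<^sub>F at_left 1. norm (?f k r) \<le> 2 * c k"
        using eventually_prodI[OF always_eventually[of "\<lambda>_. True"]]
        by (intro eventually_prod_filter[THEN iffD2] exI[of _ "\<lambda>_. True"]
              exI[of _ "\<lambda>r. \<forall>k. norm (?f k r) \<le> 2 * c k"]) auto
      show "summable (\<lambda>k. 2 * c k)" by (intro summable_mult sum_c)
    qed auto
    then have "((\<lambda>r. suminf (\<lambda>n. ?f n r)) \<longlongrightarrow> 0) (at_left 1)" by simp
    moreover have "\<forall>\<^sub>F r in at_left 1. suminf (\<lambda>n. ?f n r) = X r"
      using eventually_at_left_real[of 0 1, OF zero_less_one]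
      by (rule eventually_mono) (use Xsum in \<open>auto simp: sums_iff\<close>)
    ultimately show ?thesis by (rule Lim_transform_eventually)
  qed
  \<comment> \<open>The inequality of Cauchy and Schwarz in the form of the arithmetic-geometric mean inequality, with
    a parameter \<open>e\<close> to be chosen after the limit \<open>r \<rightarrow> 1\<close>.\<close>
  have S_le_X: "S r \<le> C * (e + X r / (m * e)) / 2" if r: "0 < r" "r < 1" and e: "0 < e" for r e
  proof -
    define E2 where "E2 = energy (deriv (deriv a)) (deriv (deriv b))"
    have cE2: "continuous_on (sphere 0 r) E2"
      using continuous_on_energy[OF holomorphic_deriv[OF holomorphic_deriv[OF a_holo open_ball] open_ball]
        holomorphic_deriv[OF holomorphic_deriv[OF b_holo open_ball] open_ball]] r
      by (auto simp: E2_def elim!: continuous_on_subset)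
    define k where "k = C * (1 - r)\<^sup>2 / (m * e) / 2"
    have "cmod (circle_mean r (\<lambda>z. z\<^sup>2 * q z * of_real (B - N z)))
       \<le> Re (circle_mean r (\<lambda>z. of_real (C * e / 2) + of_real k * of_real (E2 z)))"
    proof (rule norm_circle_mean_le)
      fix z assume zr: "cmod z = r"
      then have z: "z \<in> ball 0 1" using r by simp
      have "(cmod (q z))\<^sup>2 * m \<le> E2 z"
        unfolding E2_def energy_second_deriv[OF z] by (intro mult_left_mono m z) auto
      then have q2: "(cmod (q z))\<^sup>2 \<le> E2 z / m" using m by (simp add: field_simps)
      have "0 \<le> (cmod (q z) * (1 - r) - e)\<^sup>2" by simp
      then have "cmod (q z) * (1 - r) * e * 2 \<le> e\<^sup>2 + (1 - r)\<^sup>2 * (cmod (q z))\<^sup>2"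
        by (simp add: power2_eq_square algebra_simps)
      also have "\<dots> \<le> e\<^sup>2 + (1 - r)\<^sup>2 * (E2 z / m)"
        by (intro add_left_mono mult_left_mono q2) auto
      finally have "cmod (q z) * (1 - r) \<le> e / 2 + (1 - r)\<^sup>2 / (m * e) / 2 * E2 z"
        using e m by (simp add: field_simps power2_eq_square)
      then have "C * (cmod (q z) * (1 - r)) \<le> C * (e / 2 + (1 - r)\<^sup>2 / (m * e) / 2 * E2 z)"
        by (intro mult_left_mono C)
      then show "cmod (z\<^sup>2 * q z * of_real (B - N z)) \<le> Re (of_real (C * e / 2) + of_real k * of_real (E2 z))"
        using pt[OF z] zr by (simp add: k_def algebra_simps)
    qed (use cont cE2 r in \<open>auto intro!: continuous_intros\<close>)
    also have "circle_mean r (\<lambda>z. of_real (C * e / 2) + of_real k * of_real (E2 z))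
       = of_real (C * e / 2) + of_real k * circle_mean r (\<lambda>z. of_real (E2 z))"
      by (subst circle_mean_add) (use r cE2 in \<open>auto intro!: continuous_intros simp: circle_mean_cmult\<close>, simp add: circle_mean_def)
    also have "Re \<dots> = C * (e + X r / (m * e)) / 2"
      by (simp add: k_def X_def E2_def algebra_simps add_divide_distrib)
    finally show ?thesis unfolding S_def using complex_Re_le_cmod order_trans by blast
  qed
  obtain j where j: "n = j + 2" using n by (metis add.commute le_Suc_ex)
  have "c j \<le> C / 2 * e" if e: "0 < e" for e
  proof -
    have "((\<lambda>r. c j * r ^ (2 * j + 4)) \<longlongrightarrow> c j * 1 ^ (2 * j + 4)) (at_left (1::real))"
      by (intro tendsto_intros)
    moreover have "((\<lambda>r. C * (e + X r / (m * e)) / 2) \<longlongrightarrow> C * (e + 0 / (m * e)) / 2) (at_left 1)"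
      by (intro tendsto_intros X0) (use e m in auto)
    moreover have "eventually (\<lambda>r::real. c j * r ^ (2 * j + 4) \<le> C * (e + X r / (m * e)) / 2) (at_left 1)"
      using eventually_at_left_real[of 0 1, OF zero_less_one]
    proof (rule eventually_mono)
      fix r :: real assume r: "r \<in> {0<..<1}"
      have "(\<Sum>n\<in>{j}. c n * r ^ (2 * n + 4)) \<le> suminf (\<lambda>n. c n * r ^ (2 * n + 4))"
        by (rule sum_le_suminf) (use cS[of r] r c0 in \<open>auto simp: sums_iff\<close>)
      also have "\<dots> = S r" using cS[of r] r by (simp add: sums_iff)
      finally show "c j * r ^ (2 * j + 4) \<le> C * (e + X r / (m * e)) / 2"
        using S_le_X[of r e] r e by simp
    qed
    ultimately have "c j * 1 ^ (2 * j + 4) \<le> C * (e + 0 / (m * e)) / 2"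
      using tendsto_le[OF trivial_limit_at_left_real] by blast
    then show ?thesis by simp
  qed
  then have "c j \<le> 0 + e" if "0 < e" for e
  proof -
    have "c j \<le> C / 2 * (e / (C + 1))" using \<open>\<And>e. 0 < e \<Longrightarrow> c j \<le> C / 2 * e\<close>[of "e / (C + 1)"] that C(1) by simp
    also have "\<dots> \<le> e" using that C(1) by (simp add: field_simps)
    finally show ?thesis by simp
  qed
  then have "c j \<le> 0" by (rule field_le_epsilon)
  then have "c j = 0" using c0[of j] by simp
  then have "real ((j + 2) * (j + 1)) = 0 \<or> P (j + 2) = 0" by (simp only: c_def mult_eq_0_iff)
  then show ?thesis unfolding j by (simp only: of_nat_eq_0_iff) simp
qed

text \<open>For an affine \<open>w\<close>, constancy of \<open>|w|\<close> on the unit circle is orthogonality of the two coefficients, so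
  that \<open>P 0 * P 1 = 1\<close>.\<close>
lemma constant_boundary_values_imp_extremal:
  assumes bound: "\<And>z. z \<in> ball 0 1 \<Longrightarrow> N z \<le> B"
    and lim: "\<And>\<xi>. \<xi> \<in> sphere 0 1 \<Longrightarrow> (N \<longlongrightarrow> B) (at \<xi> within ball 0 1)"
  shows "N 0 + 1 / N 0 = B"
proof -
  have aff: "N z = N 0 + 2 * Re (z * overlap) + P 1 * (cmod z)\<^sup>2" if "z \<in> ball 0 1" for z
    using N_affine constant_boundary_values_imp_affine[OF bound lim] that by blast
  have bdry: "N 0 + 2 * Re (\<xi> * overlap) + P 1 = B" if xi: "\<xi> \<in> sphere 0 1" for \<xi>
  proof -
    have "((\<lambda>z. N 0 + 2 * Re (z * overlap) + P 1 * (cmod z)\<^sup>2) \<longlongrightarrow>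
        N 0 + 2 * Re (\<xi> * overlap) + P 1 * (cmod \<xi>)\<^sup>2) (at \<xi> within ball 0 1)"
      by (intro tendsto_intros)
    moreover have "\<forall>\<^sub>F z in at \<xi> within ball 0 1. N 0 + 2 * Re (z * overlap) + P 1 * (cmod z)\<^sup>2 = N z"
      unfolding eventually_at_filter by (intro always_eventually allI impI aff[symmetric])
    ultimately have "(N \<longlongrightarrow> N 0 + 2 * Re (\<xi> * overlap) + P 1 * (cmod \<xi>)\<^sup>2) (at \<xi> within ball 0 1)"
      by (rule Lim_transform_eventually)
    moreover have "at \<xi> within ball 0 1 \<noteq> bot"
      using xi by (simp add: trivial_limit_within islimpt_ball)
    ultimately show ?thesis using tendsto_unique[OF _ _ lim[OF xi]] xi by force
  qed
  have "overlap = 0"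
    using bdry[of 1] bdry[of "-1"] bdry[of \<i>] bdry[of "-\<i>"] by (auto simp: complex_eq_iff)
  then have "P 1 = 1 / N 0" "N 0 + P 1 = B"
    using P_0_mult_P_1 N_pos[of 0] bdry[of 1] by (auto simp: field_simps)
  then show ?thesis by simp
qed

end

section \<open>Homogeneous coordinates of functions with positive spherical derivative\<close>

text \<open>On a smaller disc there are finitely many zeros. They are divided out by a polynomial, and the
  zero-free quotient has a square root because a disc is simply connected.\<close>
lemma holomorphic_sqrt_smaller_disc:
  assumes G: "G holomorphic_on ball 0 1" and z0: "z0 \<in> ball 0 1" "G z0 \<noteq> 0"
    and double: "\<And>p. p \<in> ball 0 1 \<Longrightarrow> G p = 0 \<Longrightarrow> zorder G p = 2" and r: "r < 1"
  obtains k where "k holomorphic_on ball 0 r" "\<And>z. z \<in> ball 0 r \<Longrightarrow> (k z)\<^sup>2 = G z"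
proof -
  define Z where "Z = {z \<in> ball 0 r. G z = 0}"
  have sub: "ball 0 r \<subseteq> ball (0::complex) 1" "cball 0 r \<subseteq> ball (0::complex) 1" using r by auto
  have "finite Z"
  proof (cases "G constant_on ball 0 1")
    case True
    then have "Z = {}" using z0 sub by (auto simp: Z_def constant_on_def)
    then show ?thesis by simp
  next
    case False
    have "finite {z \<in> cball 0 r. G z = 0}"
      by (rule holomorphic_compact_finite_zeros[OF G]) (use False sub in auto)
    then show ?thesis by (rule finite_subset[rotated]) (auto simp: Z_def)
  qed
  define R where "R z = (\<Prod>p\<in>Z. z - p)" for z :: complex
  have R0: "R z = 0 \<longleftrightarrow> z \<in> Z" for z using \<open>finite Z\<close> by (auto simp: R_def)
  have R_holo: "R holomorphic_on S" for S unfolding R_def by (intro holomorphic_intros)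
  have Gr: "G holomorphic_on ball 0 r" by (rule holomorphic_on_subset[OF G sub(1)])
  obtain g where g: "g holomorphic_on ball 0 r" "\<And>z. z \<in> ball 0 r \<Longrightarrow> g z \<noteq> 0"
      "\<And>z. z \<in> ball 0 r \<Longrightarrow> G z = g z * (R z)\<^sup>2"
  proof (rule holomorphic_zorder_factorization[of G "ball 0 r" "\<lambda>z. (R z)\<^sup>2"])
    show "(\<lambda>z. (R z)\<^sup>2) holomorphic_on ball 0 r" by (intro holomorphic_intros R_holo)
    show "(R z)\<^sup>2 = 0 \<longleftrightarrow> G z = 0" if "z \<in> ball 0 r" for z using that R0 by (auto simp: Z_def)
    show "zorder (\<lambda>z. (R z)\<^sup>2) z = zorder G z" if z: "z \<in> ball 0 r" for z
    proof (cases "G z = 0")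
      case True
      then have zZ: "z \<in> Z" using z by (simp add: Z_def)
      have "zorder (\<lambda>z. (R z)\<^sup>2) z = 2"
      proof (rule zorder_eqI[of UNIV z "\<lambda>w. (\<Prod>p\<in>Z - {z}. w - p)\<^sup>2"])
        show "(\<Prod>p\<in>Z - {z}. z - p)\<^sup>2 \<noteq> 0" using \<open>finite Z\<close> by auto
        show "(R w)\<^sup>2 = (\<Prod>p\<in>Z - {z}. w - p)\<^sup>2 * (w - z) powi 2" for w
          unfolding R_def using prod.remove[OF \<open>finite Z\<close> zZ, of "\<lambda>p. w - p"]
          by (simp add: power_mult_distrib)
      qed (auto intro!: holomorphic_intros)
      moreover have "zorder G z = 2" using double True z sub by blast
      ultimately show ?thesis by simp
    next
      case False
      then have "zorder G z = 0" using Gr z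
        by (intro zorder_eq_0I) (auto simp: analytic_at intro!: exI[of _ "ball 0 r"])
      moreover have "zorder (\<lambda>z. (R z)\<^sup>2) z = 0"
        by (rule zorder_eq_0I) (use False R0 in \<open>auto simp: Z_def analytic_at intro!: exI[of _ UNIV] holomorphic_intros R_holo\<close>)
      ultimately show ?thesis by simp
    qed
  qed (use Gr in auto)
  have "simply_connected (ball (0::complex) r)" by (intro convex_imp_simply_connected) simp
  then obtain s where s: "s holomorphic_on ball 0 r" "\<And>z. z \<in> ball 0 r \<Longrightarrow> g z = (s z)\<^sup>2"
    using simply_connected_eq_holomorphic_sqrt[of "ball 0 r"] g by blast
  show ?thesis
    by (rule that[of "\<lambda>z. s z * R z"])
       (use s g in \<open>auto intro!: holomorphic_intros R_holo simp: power_mult_distrib\<close>)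
qed

lemma holomorphic_sqrt_unique:
  assumes f: "f holomorphic_on S" and g: "g holomorphic_on S" and S: "open S" "connected S"
    and sq: "\<And>z. z \<in> S \<Longrightarrow> (f z)\<^sup>2 = (g z)\<^sup>2" and z0: "z0 \<in> S" "f z0 = g z0" "f z0 \<noteq> 0" and z: "z \<in> S"
  shows "f z = g z"
proof -
  have c: "continuous_on S (\<lambda>z. f z + g z)"
    using f g by (intro continuous_intros holomorphic_on_imp_continuous_on)
  define U where "U = S \<inter> (\<lambda>z. f z + g z) -` (- {0})"
  have U: "open U" "z0 \<in> U" "U \<subseteq> S"
    unfolding U_def using continuous_open_preimage[OF c \<open>open S\<close>, of "- {0}"] z0 by auto
  have eq: "f w = g w" if "w \<in> U" for w
  proof -
    have "(f w - g w) * (f w + g w) = 0" using sq[of w] that U by (auto simp: algebra_simps power2_eq_square)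
    then show ?thesis using that by (auto simp: U_def)
  qed
  show ?thesis
    by (rule analytic_continuation_open[OF U(1) S(1) _ S(2) U(3) f g eq z]) (use U in auto)
qed

text \<open>The zeros may accumulate at the unit circle, so the square roots on smaller discs are glued. They
  agree once the sign is fixed at a point \<open>z0\<close> where \<open>G\<close> does not vanish.\<close>
lemma holomorphic_sqrt_disc:
  assumes G: "G holomorphic_on ball 0 1" and z0: "z0 \<in> ball 0 1" "G z0 \<noteq> 0"
    and double: "\<And>p. p \<in> ball 0 1 \<Longrightarrow> G p = 0 \<Longrightarrow> zorder G p = 2"
  obtains k where "k holomorphic_on ball 0 1" "\<And>z. z \<in> ball 0 1 \<Longrightarrow> (k z)\<^sup>2 = G z"
proof -
  define s where "s = csqrt (G z0)"
  have s: "s\<^sup>2 = G z0" "s \<noteq> 0" using z0 by (auto simp: s_def)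
  have "\<exists>k. k holomorphic_on ball 0 r \<and> (\<forall>z\<in>ball 0 r. (k z)\<^sup>2 = G z) \<and> k z0 = s"
    if r: "r \<in> {cmod z0<..<1}" for r
  proof -
    obtain k where k: "k holomorphic_on ball 0 r" "\<And>z. z \<in> ball 0 r \<Longrightarrow> (k z)\<^sup>2 = G z"
      using holomorphic_sqrt_smaller_disc[OF G z0 double, of r] r by auto
    have "(k z0)\<^sup>2 = s\<^sup>2" using k(2)[of z0] r s by simp
    then consider "k z0 = s" | "- k z0 = s" using power2_eq_iff by fastforce
    then show ?thesis
    proof cases
      case 1 then show ?thesis using k by blast
    next
      case 2 then show ?thesis using k
        by (intro exI[of _ "\<lambda>z. - k z"]) (auto intro!: holomorphic_intros)
    qed
  qed
  then obtain K where K: "\<And>r. r \<in> {cmod z0<..<1} \<Longrightarrow> K r holomorphic_on ball 0 r"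
     "\<And>r z. r \<in> {cmod z0<..<1} \<Longrightarrow> z \<in> ball 0 r \<Longrightarrow> (K r z)\<^sup>2 = G z"
     "\<And>r. r \<in> {cmod z0<..<1} \<Longrightarrow> K r z0 = s"
    by metis
  have agree: "K r z = K t z" if "r \<in> {cmod z0<..<1}" "t \<in> {cmod z0<..<1}" "r \<le> t" "z \<in> ball 0 r" for r t z
    by (rule holomorphic_sqrt_unique[of "K r" "ball 0 r" "K t" z0])
       (use that K s in \<open>auto intro: holomorphic_on_subset[OF K(1)]\<close>)
  define k where "k z = K ((1 + max (cmod z0) (cmod z)) / 2) z" for z
  have k: "k z = K r z" if r: "r \<in> {cmod z0<..<1}" and z: "z \<in> ball 0 r" for r z
  proof -
    define t where "t = (1 + max (cmod z0) (cmod z)) / 2"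
    have t: "t \<in> {cmod z0<..<1}" "z \<in> ball 0 t" using r z z0 by (auto simp: t_def max_def)
    have "K t z = K r z"
    proof (cases "r \<le> t")
      case True then show ?thesis using agree[OF r t(1) _ z] by simp
    next
      case False then show ?thesis using agree[OF t(1) r _ t(2)] by simp
    qed
    then show ?thesis by (simp only: k_def t_def)
  qed
  have un: "(\<Union>r\<in>{cmod z0<..<1}. ball 0 r) = ball (0::complex) 1"
  proof (intro equalityI subsetI)
    fix z :: complex assume "z \<in> ball 0 1"
    then have "max (cmod z0) (cmod z) < 1" using z0 by simp
    then obtain r where "max (cmod z0) (cmod z) < r" "r < 1" using dense by blast
    then show "z \<in> (\<Union>r\<in>{cmod z0<..<1}. ball 0 r)" by auto
  qed auto
  show ?thesis
  proof (rule that)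
    have "k holomorphic_on (\<Union>r\<in>{cmod z0<..<1}. ball 0 r)"
    proof (rule holomorphic_on_UN_open)
      fix r assume r: "r \<in> {cmod z0<..<1}"
      show "k holomorphic_on ball 0 r"
        using K(1)[OF r] by (rule holomorphic_transform) (use k[OF r] in auto)
    qed auto
    then show "k holomorphic_on ball 0 1" by (simp only: un)
    fix z :: complex assume "z \<in> ball 0 1"
    then obtain r where "r \<in> {cmod z0<..<1}" "z \<in> ball 0 r" using un by blast
    then show "(k z)\<^sup>2 = G z" using k K(2) by simp
  qed
qed

text \<open>With \<open>h = 1/F\<close>, the lower bound on the spherical derivative passes to \<open>|h'|\<close> at a pole, so poles are
  simple and \<open>G = 1/F' = - h\<^sup>2 / h'\<close> has a double zero there. The pair is \<open>b = sqrt G\<close> and \<open>a = F b\<close>; the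
  latter extends over a pole because \<open>b\<close> and \<open>h\<close> both have simple zeros, with value \<open>b' / h'\<close>.
  The Wronskian and the formula for the spherical derivative hold off the poles by computation and at
  the poles by continuity.\<close>
lemma spherical_derivative_eq_energy:
  assumes c: "0 < c" and F: "F \<in> F_class c"
  obtains a b where "unimodular_pair a b" "\<And>z. z \<in> ball 0 1 \<Longrightarrow> sph_deriv F z = 1 / energy a b z"
proof -
  let ?D = "ball (0::complex) 1"
  have mero: "F nicely_meromorphic_on ?D" and low: "\<And>z. z \<in> ?D \<Longrightarrow> c \<le> sph_deriv F z"
    using F by (auto simp: F_class_def)
  define h where "h z = inverse (F z)" for z
  have h_mero: "h nicely_meromorphic_on ?D" unfolding h_def[abs_def] by (rule nicely_meromorphic_on_inverse[OF mero])
  have ana: "F analytic_on {z}" if "z \<in> ?D" "\<not> is_pole F z" for z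
    by (rule nicely_meromorphic_on_imp_analytic_at[OF mero that])
  have reg: "\<forall>\<^sub>F w in at z. w \<in> ?D \<and> \<not> is_pole F w" if z: "z \<in> ?D" for z
  proof -
    have "F meromorphic_on {z}" using mero z meromorphic_on_subset unfolding nicely_meromorphic_on_def by blast
    then have "\<forall>\<^sub>F w in at z. \<not> is_pole F w"
      by (intro eventually_not_pole meromorphic_on_isolated_singularity)
    moreover have "\<forall>\<^sub>F w in at z. w \<in> ?D"
      using z by (intro eventually_at_in_open') auto
    ultimately show ?thesis by eventually_elim auto
  qed
  have low': "c \<le> cmod (deriv F z) / (1 + (cmod (F z))\<^sup>2)" if "z \<in> ?D" "\<not> is_pole F z" for z
    using low[OF that(1)] that(2) by (simp add: sph_deriv_def)
  have dF0: "deriv F z \<noteq> 0" if "z \<in> ?D" "\<not> is_pole F z" for z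
    using low'[OF that] c by auto
  have pole: "h analytic_on {p}" "F p = 0" "h p = 0" "\<forall>\<^sub>F w in at p. h w \<noteq> 0" if p: "p \<in> ?D" "is_pole F p" for p
  proof -
    show F0: "F p = 0" by (rule is_pole_zero_at_nicely_mero[OF mero p(2,1)])
    then show "h p = 0" by (simp add: h_def)
    have "isolated_zero h p" unfolding h_def[abs_def] using p by (simp add: isolated_zero_inverse_iff)
    then have "h \<midarrow>p\<rightarrow> 0" and nz: "\<forall>\<^sub>F w in at p. h w \<noteq> 0" by (auto simp: isolated_zero_def)
    then have "\<not> is_pole h p"
      unfolding is_pole_def using not_tendsto_and_filterlim_at_infinity by (metis trivial_limit_at)
    then show "h analytic_on {p}" by (rule nicely_meromorphic_on_imp_analytic_at[OF h_mero p(1)])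
    show "\<forall>\<^sub>F w in at p. h w \<noteq> 0" by (rule nz)
  qed
  have h_deriv: "\<forall>\<^sub>F w in at p. deriv F w = - deriv h w / (h w)\<^sup>2 \<and> h w \<noteq> 0 \<and> w \<in> ?D \<and> \<not> is_pole F w"
    if p: "p \<in> ?D" "is_pole F p" for p
    using reg[OF p(1)] pole(4)[OF p]
  proof eventually_elim
    case (elim w)
    have "(F has_field_derivative deriv F w) (at w)"
      using ana[of w] elim by (auto intro: analytic_derivI)
    then have "(h has_field_derivative - (inverse (F w) * deriv F w * inverse (F w))) (at w)"
      unfolding h_def[abs_def] using elim by (intro DERIV_inverse') (auto simp: h_def)
    then have "deriv h w = - (inverse (F w) * deriv F w * inverse (F w))" by (rule DERIV_imp_deriv)
    then show ?case using elim by (simp add: h_def power2_eq_square field_simps)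
  qed
  have dh: "deriv h p \<noteq> 0" if p: "p \<in> ?D" "is_pole F p" for p
  proof -
    have "isCont (deriv h) p"
      by (intro analytic_at_imp_isCont analytic_deriv pole(1)[OF p])
    then have lim: "((\<lambda>w. cmod (deriv h w)) \<longlongrightarrow> cmod (deriv h p)) (at p)"
      by (intro tendsto_norm) (simp add: isCont_def)
    have "\<forall>\<^sub>F w in at p. c \<le> cmod (deriv h w)"
      using h_deriv[OF p]
    proof eventually_elim
      case (elim w)
      then have Fw: "F w = inverse (h w)" "0 < cmod (h w)" by (auto simp: h_def)
      have "c \<le> cmod (deriv F w) / (1 + (cmod (F w))\<^sup>2)" using low' elim by blast
      also have "\<dots> = cmod (deriv h w) / ((cmod (h w))\<^sup>2 + 1)"
      proof -
        have "cmod (deriv F w) = cmod (deriv h w) / (cmod (h w))\<^sup>2"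
          using elim by (metis norm_divide norm_minus_cancel norm_power)
        moreover have "cmod (F w) = 1 / cmod (h w)" by (simp add: Fw(1) norm_inverse divide_inverse)
        moreover have "x / t\<^sup>2 / (1 + (1 / t)\<^sup>2) = x / (t\<^sup>2 + 1)" if "0 < t" for x t :: real
        proof -
          have "t\<^sup>2 * (1 + (1 / t)\<^sup>2) = t\<^sup>2 + 1" using that by (simp add: distrib_left power_divide)
          then show ?thesis by (simp only: divide_divide_eq_left)
        qed
        ultimately show ?thesis using Fw(2) by (simp only:)
      qed
      also have "\<dots> \<le> cmod (deriv h w)"
        by (simp add: pos_divide_le_eq add_nonneg_pos distrib_left)
      finally show ?case .
    qed
    then have "c \<le> cmod (deriv h p)" using lim by (intro tendsto_lowerbound) auto
    then show ?thesis using c by auto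
  qed
  define G where "G z = (if is_pole F z then 0 else 1 / deriv F z)" for z
  have G0: "G z = 0 \<longleftrightarrow> is_pole F z" if "z \<in> ?D" for z using dF0[OF that] by (simp add: G_def)
  have G_pole: "\<forall>\<^sub>F w in nhds p. G w = h w * (h w * (- 1 / deriv h w))" if p: "p \<in> ?D" "is_pole F p" for p
  proof -
    have "\<forall>\<^sub>F w in at p. G w = h w * (h w * (- 1 / deriv h w))"
      using h_deriv[OF p] by eventually_elim (auto simp: G_def field_simps power2_eq_square)
    then show ?thesis using p pole[OF p] by (auto simp: eventually_nhds_conv_at G_def)
  qed
  have reg_nhds: "\<forall>\<^sub>F w in nhds z. \<not> is_pole F w" if "z \<in> ?D" "\<not> is_pole F z" for z
    using reg[OF that(1)] that by (auto simp: eventually_nhds_conv_at elim: eventually_mono)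
  have G_ana: "G analytic_on {z}" if z: "z \<in> ?D" for z
  proof (cases "is_pole F z")
    case True
    have "(\<lambda>w. h w * (h w * (- 1 / deriv h w))) analytic_on {z}"
      by (intro analytic_intros pole[OF z True]) (use dh[OF z True] in auto)
    then show ?thesis using analytic_at_cong[OF G_pole[OF z True] refl] by simp
  next
    case False
    have "(\<lambda>w. 1 / deriv F w) analytic_on {z}"
      by (intro analytic_intros ana[OF z False]) (use dF0[OF z False] in auto)
    moreover have "\<forall>\<^sub>F w in nhds z. G w = 1 / deriv F w"
      using reg_nhds[OF z False] by eventually_elim (simp add: G_def)
    ultimately show ?thesis using analytic_at_cong[of G "\<lambda>w. 1 / deriv F w" z z] by simp
  qed
  have G_holo: "G holomorphic_on ?D"
    using G_ana analytic_on_analytic_at analytic_imp_holomorphic by metis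
  have double: "zorder G p = 2" if p: "p \<in> ?D" "G p = 0" for p
  proof -
    have pl: "is_pole F p" using G0 p by simp
    note hp = pole[OF p(1) pl]
    obtain S where S: "open S" "p \<in> S" "h holomorphic_on S" using hp(1) by (auto simp: analytic_at)
    have zh: "zorder h p = 1"
      by (rule zorder_zero_eqI[OF S(3,1,2)]) (use hp dh[OF p(1) pl] in auto)
    have ad: "(\<lambda>w. - 1 / deriv h w) analytic_on {p}"
      by (intro analytic_intros hp) (use dh[OF p(1) pl] in auto)
    have z0: "zorder (\<lambda>w. - 1 / deriv h w) p = 0"
      by (rule zorder_eq_0I[OF ad]) (use dh[OF p(1) pl] in auto)
    have ev: "\<forall>\<^sub>F w in at p. G w \<noteq> 0"
      using reg[OF p(1)] by eventually_elim (use G0 in auto)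
    have evG: "\<forall>\<^sub>F w in at p. G w = h w * (h w * (- 1 / deriv h w))"
      using G_pole[OF p(1) pl] by (auto simp: eventually_nhds_conv_at)
    have nz: "\<forall>\<^sub>F w in at p. h w * (h w * (- 1 / deriv h w)) \<noteq> 0"
      using ev evG by eventually_elim simp
    have "zorder G p = zorder (\<lambda>w. h w * (h w * (- 1 / deriv h w))) p"
      by (rule zorder_cong[OF evG refl])
    also have "\<dots> = zorder h p + zorder (\<lambda>w. h w * (- 1 / deriv h w)) p"
      by (intro zorder_times_analytic hp nz analytic_on_mult ad)
    also have "zorder (\<lambda>w. h w * (- 1 / deriv h w)) p = zorder h p + zorder (\<lambda>w. - 1 / deriv h w) p"
      by (intro zorder_times_analytic hp ad) (use nz in \<open>auto elim: eventually_mono\<close>)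
    finally show ?thesis using zh z0 by simp
  qed
  obtain z0 where z0: "z0 \<in> ?D" "G z0 \<noteq> 0"
  proof -
    have "\<forall>\<^sub>F w in at 0. w \<in> ?D \<and> \<not> is_pole F w" by (rule reg) simp
    then obtain w where "w \<in> ?D" "\<not> is_pole F w" using eventually_happens[of _ "at (0::complex)"] by auto
    then show ?thesis using that G0 by blast
  qed
  obtain b where b_holo: "b holomorphic_on ?D" and b2: "\<And>z. z \<in> ?D \<Longrightarrow> (b z)\<^sup>2 = G z"
    using holomorphic_sqrt_disc[OF G_holo z0 double] by blast
  have b0: "b z = 0 \<longleftrightarrow> is_pole F z" if "z \<in> ?D" for z
    using b2[OF that] G0[OF that] by (metis power2_eq_iff zero_eq_power2)
  have b_ana: "b analytic_on {z}" if "z \<in> ?D" for z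
    using b_holo that by (auto simp: analytic_at intro!: exI[of _ ?D])
  define a where "a z = (if is_pole F z then deriv b z / deriv h z else F z * b z)" for z
  have a_cong: "\<forall>\<^sub>F w in nhds z. a w = F w * b w" if "z \<in> ?D" "\<not> is_pole F z" for z
    using reg_nhds[OF that] by eventually_elim (simp add: a_def)
  have a_ana_reg: "a analytic_on {z}" if z: "z \<in> ?D" "\<not> is_pole F z" for z
  proof -
    have "(\<lambda>w. F w * b w) analytic_on {z}" by (intro analytic_intros ana z b_ana)
    then show ?thesis using analytic_at_cong[OF a_cong[OF z] refl] by simp
  qed
  have a_lim: "(a \<longlongrightarrow> a p) (at p)" if p: "p \<in> ?D" "is_pole F p" for p
  proof -
    have "((\<lambda>w. (b w - b p) / (w - p)) \<longlongrightarrow> deriv b p) (at p)"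
      using analytic_derivI[OF b_ana[OF p(1)], of UNIV] by (simp add: has_field_derivative_iff)
    moreover have "((\<lambda>w. (h w - h p) / (w - p)) \<longlongrightarrow> deriv h p) (at p)"
      using analytic_derivI[OF pole(1)[OF p], of UNIV] by (simp add: has_field_derivative_iff)
    ultimately have "((\<lambda>w. ((b w - b p) / (w - p)) / ((h w - h p) / (w - p))) \<longlongrightarrow> deriv b p / deriv h p) (at p)"
      by (intro tendsto_divide dh[OF p])
    moreover have "\<forall>\<^sub>F w in at p. ((b w - b p) / (w - p)) / ((h w - h p) / (w - p)) = a w"
    proof -
      have "\<forall>\<^sub>F w in at p. w \<noteq> p" by (simp add: eventually_at_filter)
      with reg[OF p(1)] show ?thesis
        by eventually_elim (use b0 p pole[OF p] in \<open>auto simp: a_def h_def field_simps\<close>)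
    qed
    ultimately show ?thesis using p by (simp add: a_def[of p] Lim_transform_eventually)
  qed
  have a_ana: "a analytic_on {z}" if z: "z \<in> ?D" for z
  proof (cases "is_pole F z")
    case True
    obtain e where e: "0 < e" "\<And>w. w \<in> ball z e - {z} \<Longrightarrow> w \<in> ?D \<and> \<not> is_pole F w"
      using reg[OF z] unfolding eventually_at by (auto simp: dist_commute)
    have "a holomorphic_on ball z e"
    proof (rule no_isolated_singularity'[of "{z}"])
      show "(a \<longlongrightarrow> a w) (at w within ball z e)" if "w \<in> {z}" for w
        using a_lim[OF z True] that by (auto intro: Lim_at_imp_Lim_at_within)
      have "a analytic_on ball z e - {z}"
        using e a_ana_reg by (subst analytic_on_analytic_at) blast
      then show "a holomorphic_on ball z e - {z}" by (rule analytic_imp_holomorphic)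
    qed auto
    then show ?thesis using e by (auto simp: analytic_at intro!: exI[of _ "ball z e"])
  qed (use a_ana_reg z in auto)
  have a_holo: "a holomorphic_on ?D"
    using a_ana analytic_on_analytic_at analytic_imp_holomorphic by metis
  have W_reg: "deriv a z * b z - a z * deriv b z = 1" if z: "z \<in> ?D" "\<not> is_pole F z" for z
  proof -
    have "(F has_field_derivative deriv F z) (at z)" "(b has_field_derivative deriv b z) (at z)"
      using analytic_derivI[OF ana[OF z], of UNIV] analytic_derivI[OF b_ana[OF z(1)], of UNIV] by auto
    then have "((\<lambda>w. F w * b w) has_field_derivative deriv F z * b z + deriv b z * F z) (at z)"
      by (rule DERIV_mult)
    then have "deriv (\<lambda>w. F w * b w) z = deriv F z * b z + deriv b z * F z" by (rule DERIV_imp_deriv)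
    moreover have "deriv a z = deriv (\<lambda>w. F w * b w) z" by (rule deriv_cong_ev[OF a_cong[OF z] refl])
    ultimately have "deriv a z * b z - a z * deriv b z = deriv F z * (b z)\<^sup>2"
      using z by (simp add: a_def algebra_simps power2_eq_square)
    also have "\<dots> = 1" using b2[OF z(1)] dF0[OF z] z by (simp add: G_def)
    finally show ?thesis .
  qed
  have W: "deriv a z * b z - a z * deriv b z = 1" if z: "z \<in> ?D" for z
  proof -
    have "isCont (\<lambda>w. deriv a w * b w - a w * deriv b w) z"
      by (intro analytic_at_imp_isCont analytic_intros a_ana b_ana z)
    then have "((\<lambda>w. deriv a w * b w - a w * deriv b w) \<longlongrightarrow> deriv a z * b z - a z * deriv b z) (at z)"
      by (simp add: isCont_def)
    moreover have "\<forall>\<^sub>F w in at z. deriv a w * b w - a w * deriv b w = 1"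
      using reg[OF z] by eventually_elim (use W_reg in auto)
    then have "((\<lambda>w. deriv a w * b w - a w * deriv b w) \<longlongrightarrow> 1) (at z)" by (rule tendsto_eventually)
    ultimately show ?thesis using tendsto_unique[OF trivial_limit_at] by blast
  qed
  interpret unimodular_pair a b by unfold_locales (use a_holo b_holo W in auto)
  have sph_reg: "cmod (deriv F z) / (1 + (cmod (F z))\<^sup>2) = 1 / energy a b z" if z: "z \<in> ?D" "\<not> is_pole F z" for z
  proof -
    have "energy a b z = (cmod (b z))\<^sup>2 * (1 + (cmod (F z))\<^sup>2)"
      using z by (simp add: energy_def a_def norm_mult power_mult_distrib algebra_simps)
    also have "(cmod (b z))\<^sup>2 = 1 / cmod (deriv F z)"
      using b2[OF z(1)] z by (metis G_def norm_divide norm_one norm_power)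
    finally show ?thesis by simp
  qed
  have sph: "sph_deriv F z = 1 / energy a b z" if z: "z \<in> ?D" for z
  proof (cases "is_pole F z")
    case True
    have "isCont (energy a b) z"
      using continuous_on_energy[OF a_holo b_holo] z by (simp add: continuous_on_eq_continuous_at)
    then have "((\<lambda>w. 1 / energy a b w) \<longlongrightarrow> 1 / energy a b z) (at z)"
      using N_pos[OF z] by (intro tendsto_intros) (auto simp: isCont_def N_def)
    moreover have "\<forall>\<^sub>F w in at z. 1 / energy a b w = cmod (deriv F w) / (1 + (cmod (F w))\<^sup>2)"
      using reg[OF z] by eventually_elim (use sph_reg in auto)
    ultimately have "((\<lambda>w. cmod (deriv F w) / (1 + (cmod (F w))\<^sup>2)) \<longlongrightarrow> 1 / energy a b z) (at z)"
      by (rule Lim_transform_eventually)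
    then show ?thesis using True by (simp add: sph_deriv_def tendsto_Lim)
  next
    case False then show ?thesis using sph_reg[OF z] by (simp add: sph_deriv_def)
  qed
  show ?thesis by (rule that[of a b]) (use sph in \<open>auto intro: unimodular_pair_axioms\<close>)
qed

section \<open>The extremal problems\<close>

lemma F_class_lower_bound: "f \<in> F_class c \<Longrightarrow> z \<in> ball 0 1 \<Longrightarrow> c \<le> sph_deriv f z"
  by (simp add: F_class_def)

text \<open>The dilations by which the extrema are attained: their spherical derivative
  \<open>\<eta> / (1 + \<eta>\<^sup>2 |z|\<^sup>2)\<close> decreases towards the boundary value \<open>\<eta> / (1 + \<eta>\<^sup>2) = c\<close>.\<close>
lemma scaled_identity_in_F_class:
  assumes c: "0 < c" and \<eta>: "0 < \<eta>" "\<eta> + 1 / \<eta> = 1 / c"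
  shows "(\<lambda>z. of_real \<eta> * z) \<in> F_class c" "sph_deriv (\<lambda>z. of_real \<eta> * z) 0 = \<eta>"
    and "\<xi> \<in> sphere 0 1 \<Longrightarrow> (sph_deriv (\<lambda>z. of_real \<eta> * z) \<longlongrightarrow> c) (at \<xi> within ball 0 1)"
proof -
  let ?f = "\<lambda>z::complex. of_real \<eta> * z"
  have ana: "?f analytic_on S" for S by (intro analytic_intros)
  have d: "deriv ?f z = of_real \<eta>" for z
    by (rule DERIV_imp_deriv) (auto intro!: derivative_eq_intros)
  have sph: "sph_deriv ?f z = \<eta> / (1 + (\<eta> * cmod z)\<^sup>2)" for z
    using analytic_at_imp_no_pole[OF ana, of z] \<eta> by (simp add: sph_deriv_def d norm_mult)
  have c_eq: "\<eta> / (1 + \<eta>\<^sup>2) = c"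
  proof -
    have "1 / c = (1 + \<eta>\<^sup>2) / \<eta>" using \<eta> by (simp add: field_simps power2_eq_square)
    then have "c = 1 / ((1 + \<eta>\<^sup>2) / \<eta>)" using c by (metis div_by_1 divide_divide_eq_right mult_1)
    then show ?thesis by simp
  qed
  have "c \<le> sph_deriv ?f z" if z: "z \<in> ball 0 1" for z
  proof -
    have "\<eta> * cmod z \<le> \<eta>" using z \<eta> by simp
    then have "(\<eta> * cmod z)\<^sup>2 \<le> \<eta>\<^sup>2" using \<eta> by (intro power_mono) auto
    then have "\<eta> / (1 + \<eta>\<^sup>2) \<le> \<eta> / (1 + (\<eta> * cmod z)\<^sup>2)"
      using \<eta> by (intro divide_left_mono) (auto intro!: mult_pos_pos add_pos_nonneg)
    then show ?thesis by (simp only: c_eq sph)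
  qed
  then show "?f \<in> F_class c"
    using analytic_on_imp_nicely_meromorphic_on[OF ana] by (simp add: F_class_def)
  show "sph_deriv ?f 0 = \<eta>" by (simp add: sph)
  show "(sph_deriv ?f \<longlongrightarrow> c) (at \<xi> within ball 0 1)" if "\<xi> \<in> sphere 0 1"
  proof -
    have "((\<lambda>z. \<eta> / (1 + (\<eta> * cmod z)\<^sup>2)) \<longlongrightarrow> \<eta> / (1 + (\<eta> * cmod \<xi>)\<^sup>2)) (at \<xi> within ball 0 1)"
      by (intro tendsto_intros) (auto simp: add_nonneg_eq_0_iff)
    then show ?thesis using that by (simp add: sph[abs_def] c_eq)
  qed
qed

lemma sph_deriv_interior_bound:
  assumes "0 < c" "f \<in> F_class c"
  shows "0 < sph_deriv f 0" "sph_deriv f 0 + 1 / sph_deriv f 0 \<le> 1 / c"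
proof -
  obtain a b where ab: "unimodular_pair a b" and sph: "\<And>z. z \<in> ball 0 1 \<Longrightarrow> sph_deriv f z = 1 / energy a b z"
    using spherical_derivative_eq_energy[OF assms] by blast
  interpret unimodular_pair a b by fact
  have N_le: "N z \<le> 1 / c" if z: "z \<in> ball 0 1" for z
  proof -
    have "c \<le> 1 / N z" using F_class_lower_bound[OF assms(2) z] sph[OF z] by (simp add: N_def)
    then show ?thesis using N_pos[OF z] assms(1) by (simp add: field_simps)
  qed
  have "sph_deriv f 0 = 1 / N 0" using sph[of 0] by (simp add: N_def)
  then show "0 < sph_deriv f 0" "sph_deriv f 0 + 1 / sph_deriv f 0 \<le> 1 / c"
    using interior_bound[OF N_le] N_pos[of 0] by (simp_all add: add.commute)
qed

text \<open>In homogeneous coordinates \<open>f\<^sup>\<sharp> = 1/N\<close> with \<open>N \<le> 1/c\<close>. From left to right this is the equality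
  case of the interior bound, from right to left the rigidity of constant boundary values.\<close>
lemma extremal_boundary_behaviour_iff:
  assumes c: "0 < c" and f: "f \<in> F_class c"
  shows "sph_deriv f 0 + 1 / sph_deriv f 0 = 1 / c \<longleftrightarrow>
    (\<forall>\<xi>\<in>sphere 0 1. (sph_deriv f \<longlongrightarrow> c) (at \<xi> within ball 0 1))"
proof -
  obtain a b where ab: "unimodular_pair a b" and sph: "\<And>z. z \<in> ball 0 1 \<Longrightarrow> sph_deriv f z = 1 / energy a b z"
    using spherical_derivative_eq_energy[OF assms] by blast
  interpret unimodular_pair a b by fact
  have sphN: "sph_deriv f z = 1 / N z" if "z \<in> ball 0 1" for z using sph[OF that] by (simp add: N_def)
  have N_le: "N z \<le> 1 / c" if z: "z \<in> ball 0 1" for z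
  proof -
    have "c \<le> 1 / N z" using F_class_lower_bound[OF f z] sphN[OF z] by simp
    then show ?thesis using N_pos[OF z] c by (simp add: field_simps)
  qed
  have ev: "\<forall>\<^sub>F z in at \<xi> within ball 0 1. z \<in> ball 0 1" for \<xi> :: complex
    by (auto simp: eventually_at_filter)
  have N0: "sph_deriv f 0 + 1 / sph_deriv f 0 = N 0 + 1 / N 0" by (simp add: sphN)
  show ?thesis
  proof
    assume "sph_deriv f 0 + 1 / sph_deriv f 0 = 1 / c"
    then have eq: "N 0 + 1 / N 0 = 1 / c" by (simp only: N0)
    show "\<forall>\<xi>\<in>sphere 0 1. (sph_deriv f \<longlongrightarrow> c) (at \<xi> within ball 0 1)"
    proof
      fix \<xi> :: complex assume xi: "\<xi> \<in> sphere 0 1"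
      have "((\<lambda>z. 1 / (N 0 + (cmod z)\<^sup>2 / N 0)) \<longlongrightarrow> 1 / (N 0 + (cmod \<xi>)\<^sup>2 / N 0)) (at \<xi> within ball 0 1)"
        by (intro tendsto_intros) (use N_pos[of 0] eq xi c in auto)
      moreover have "\<forall>\<^sub>F z in at \<xi> within ball 0 1. 1 / (N 0 + (cmod z)\<^sup>2 / N 0) = sph_deriv f z"
        using ev
      proof eventually_elim
        case (elim z)
        show ?case by (simp only: sphN[OF elim] extremal_is_radial[OF N_le eq elim])
      qed
      ultimately have "(sph_deriv f \<longlongrightarrow> 1 / (N 0 + (cmod \<xi>)\<^sup>2 / N 0)) (at \<xi> within ball 0 1)"
        by (rule Lim_transform_eventually)
      then show "(sph_deriv f \<longlongrightarrow> c) (at \<xi> within ball 0 1)" using eq xi by simp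
    qed
  next
    assume lim: "\<forall>\<xi>\<in>sphere 0 1. (sph_deriv f \<longlongrightarrow> c) (at \<xi> within ball 0 1)"
    have "(N \<longlongrightarrow> 1 / c) (at \<xi> within ball 0 1)" if "\<xi> \<in> sphere 0 1" for \<xi>
    proof (rule Lim_transform_eventually)
      show "((\<lambda>z. 1 / sph_deriv f z) \<longlongrightarrow> 1 / c) (at \<xi> within ball 0 1)"
        using lim that c by (intro tendsto_intros) auto
      show "\<forall>\<^sub>F z in at \<xi> within ball 0 1. 1 / sph_deriv f z = N z"
        using ev by eventually_elim (simp add: sphN)
    qed
    from constant_boundary_values_imp_extremal[OF N_le this]
    show "sph_deriv f 0 + 1 / sph_deriv f 0 = 1 / c" by (simp only: N0)
  qed
qed

text \<open>The hypothesis is \<open>(x - \<eta>) * (x - 1/\<eta>) \<le> 0\<close> after multiplication by \<open>x\<close>.\<close>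
lemma between_inverse_and_self:
  fixes x \<eta> :: real
  assumes "0 < x" "0 < \<eta>" "1 \<le> \<eta>" "x + 1 / x \<le> \<eta> + 1 / \<eta>"
  shows "1 / \<eta> \<le> x" "x \<le> \<eta>"
proof -
  have "x * (x + 1 / x) \<le> x * (\<eta> + 1 / \<eta>)" using assms by (intro mult_left_mono) auto
  moreover have "(x - \<eta>) * (x - 1 / \<eta>) = x * (x + 1 / x) - x * (\<eta> + 1 / \<eta>)"
    using assms by (simp add: field_simps)
  ultimately have "(x - \<eta>) * (x - 1 / \<eta>) \<le> 0" by simp
  moreover have "1 / \<eta> \<le> \<eta>" using assms by (simp add: field_simps mult_le_cancel_left1 order_trans[of 1 \<eta> "\<eta> * \<eta>"])
  ultimately show "1 / \<eta> \<le> x" "x \<le> \<eta>" by (auto simp: mult_le_0_iff)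
qed

text \<open>The larger root of \<open>\<eta>\<^sup>2 - s \<eta> + 1\<close>.\<close>
lemma sum_with_inverse_surj:
  fixes s :: real
  assumes "2 \<le> s"
  obtains \<eta> where "1 \<le> \<eta>" "\<eta> + 1 / \<eta> = s"
proof
  define d where "d = sqrt (s\<^sup>2 - 4)"
  have "2 * 2 \<le> s * s" using assms by (intro mult_mono) auto
  then have d: "0 \<le> d" "d * d = s * s - 4" by (auto simp: d_def power2_eq_square)
  show "1 \<le> (s + d) / 2" using assms d by simp
  have "0 < s + d" using assms d by simp
  have "(s + d) * (s - d) = 4" using d by (simp add: algebra_simps)
  then have "1 / ((s + d) / 2) = (s - d) / 2" using \<open>0 < s + d\<close> by (simp add: field_simps)
  then show "(s + d) / 2 + 1 / ((s + d) / 2) = s" by (simp add: field_simps)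
qed

text \<open>The class is nonempty only if \<open>1/c \<ge> 2\<close>, because \<open>x + 1/x \<ge> 2\<close> for the value \<open>x\<close> at the centre of any
  member.\<close>
lemma F_class_extremal_parameter:
  assumes c: "0 < c" and F: "F \<in> F_class c"
  obtains \<eta> where "1 \<le> \<eta>" "\<eta> + 1 / \<eta> = 1 / c"
proof -
  define x where "x = sph_deriv F 0"
  have x: "0 < x" "x + 1 / x \<le> 1 / c" using sph_deriv_interior_bound[OF c F] by (simp_all add: x_def)
  have "0 \<le> (x - 1)\<^sup>2 / x" using x by simp
  also have "\<dots> = x + 1 / x - 2" using x by (simp add: field_simps power2_eq_square)
  finally have "2 \<le> 1 / c" using x by simp
  then show ?thesis using sum_with_inverse_surj that by blast
qed

text \<open>The values at the centre lie in \<open>[1/\<eta>, \<eta>]\<close> and the dilations attain the ends, which are the two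
  solutions of \<open>x + 1/x = 1/c\<close>: the larger one is the maximum, the smaller one the minimum.\<close>
lemma interior_extremal_iff:
  assumes c: "0 < c" and F: "F \<in> F_class c"
  shows "(\<forall>f\<in>F_class c. sph_deriv f 0 \<le> sph_deriv F 0) \<or> (\<forall>f\<in>F_class c. sph_deriv F 0 \<le> sph_deriv f 0)
     \<longleftrightarrow> sph_deriv F 0 + 1 / sph_deriv F 0 = 1 / c"
proof
  obtain \<eta> where \<eta>: "1 \<le> \<eta>" "\<eta> + 1 / \<eta> = 1 / c" using F_class_extremal_parameter[OF assms] .
  have b: "1 / \<eta> \<le> sph_deriv F 0" "sph_deriv F 0 \<le> \<eta>"
    using between_inverse_and_self[of "sph_deriv F 0" \<eta>] sph_deriv_interior_bound[OF assms] \<eta> by auto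
  assume "(\<forall>f\<in>F_class c. sph_deriv f 0 \<le> sph_deriv F 0) \<or> (\<forall>f\<in>F_class c. sph_deriv F 0 \<le> sph_deriv f 0)"
  then show "sph_deriv F 0 + 1 / sph_deriv F 0 = 1 / c"
  proof
    assume "\<forall>f\<in>F_class c. sph_deriv f 0 \<le> sph_deriv F 0"
    then have "\<eta> \<le> sph_deriv F 0" using scaled_identity_in_F_class[OF c _ \<eta>(2)] \<eta>(1) by force
    then have "sph_deriv F 0 = \<eta>" using b by simp
    then show ?thesis using \<eta> by simp
  next
    assume *: "\<forall>f\<in>F_class c. sph_deriv F 0 \<le> sph_deriv f 0"
    have "0 < 1 / \<eta>" "1 / \<eta> + 1 / (1 / \<eta>) = 1 / c" using \<eta> by (simp_all add: add.commute)
    from scaled_identity_in_F_class[OF c this] * have "sph_deriv F 0 \<le> 1 / \<eta>" by force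
    then have "sph_deriv F 0 = 1 / \<eta>" using b by simp
    then show ?thesis using \<eta> by (simp add: add.commute)
  qed
next
  assume eq: "sph_deriv F 0 + 1 / sph_deriv F 0 = 1 / c"
  define x where "x = sph_deriv F 0"
  have x: "0 < x" "x + 1 / x = 1 / c" using sph_deriv_interior_bound(1)[OF assms] eq by (simp_all add: x_def)
  show "(\<forall>f\<in>F_class c. sph_deriv f 0 \<le> sph_deriv F 0) \<or> (\<forall>f\<in>F_class c. sph_deriv F 0 \<le> sph_deriv f 0)"
  proof (cases "1 \<le> x")
    case True
    then have "sph_deriv f 0 \<le> x" if "f \<in> F_class c" for f
      using between_inverse_and_self(2)[of "sph_deriv f 0" x] sph_deriv_interior_bound[OF c that] x by simp
    then show ?thesis by (simp add: x_def)
  next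
    case False
    then have "1 \<le> 1 / x" "0 < 1 / x" using x by simp_all
    then have "1 / (1 / x) \<le> sph_deriv f 0" if "f \<in> F_class c" for f
      using between_inverse_and_self(1)[of "sph_deriv f 0" "1 / x"] sph_deriv_interior_bound[OF c that] x
      by (simp add: add.commute)
    then show ?thesis by (simp add: x_def)
  qed
qed

text \<open>The upper limit is at least \<open>c\<close> for every member of the class and equals \<open>c\<close> for the dilations with
  \<open>\<eta> + 1/\<eta> = 1/c\<close>.\<close>
lemma boundary_extremal_iff:
  assumes c: "0 < c" and F: "F \<in> F_class c"
  shows "(\<forall>\<xi>\<in>sphere (0::complex) 1. \<forall>f\<in>F_class c.
            Limsup (at \<xi> within ball 0 1) (\<lambda>z. ereal (sph_deriv F z))
              \<le> Limsup (at \<xi> within ball 0 1) (\<lambda>z. ereal (sph_deriv f z)))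
     \<longleftrightarrow> (\<forall>\<xi>\<in>sphere 0 1. (sph_deriv F \<longlongrightarrow> c) (at \<xi> within ball 0 1))"
proof -
  obtain \<eta> where \<eta>: "1 \<le> \<eta>" "\<eta> + 1 / \<eta> = 1 / c" using F_class_extremal_parameter[OF assms] .
  let ?g = "\<lambda>z::complex. of_real \<eta> * z"
  have g: "?g \<in> F_class c"
    "\<And>\<xi>. \<xi> \<in> sphere 0 1 \<Longrightarrow> (sph_deriv ?g \<longlongrightarrow> c) (at \<xi> within ball 0 1)"
    using scaled_identity_in_F_class[OF c _ \<eta>(2)] \<eta>(1) by auto
  have ev: "\<forall>\<^sub>F z in at \<xi> within ball 0 1. c \<le> sph_deriv f z" if "f \<in> F_class c" for f \<xi>
    using that by (auto simp: eventually_at_filter F_class_def)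
  have nt: "at \<xi> within ball 0 1 \<noteq> bot" if "\<xi> \<in> sphere 0 1" for \<xi> :: complex
    using that by (simp add: trivial_limit_within islimpt_ball)
  have ge: "ereal c \<le> Limsup (at \<xi> within ball 0 1) (\<lambda>z. ereal (sph_deriv f z))"
    if f: "f \<in> F_class c" and xi: "\<xi> \<in> sphere 0 1" for f \<xi>
  proof -
    have "ereal c = Limsup (at \<xi> within ball 0 1) (\<lambda>z. ereal c)"
      by (rule Limsup_const[OF nt[OF xi], symmetric])
    also have "\<dots> \<le> Limsup (at \<xi> within ball 0 1) (\<lambda>z. ereal (sph_deriv f z))"
      by (rule Limsup_mono) (use ev[OF f] in auto)
    finally show ?thesis .
  qed
  have lim_iff: "(sph_deriv f \<longlongrightarrow> c) (at \<xi> within ball 0 1) \<longleftrightarrow>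
      Limsup (at \<xi> within ball 0 1) (\<lambda>z. ereal (sph_deriv f z)) \<le> ereal c"
    if f: "f \<in> F_class c" and xi: "\<xi> \<in> sphere 0 1" for f \<xi>
  proof
    assume "(sph_deriv f \<longlongrightarrow> c) (at \<xi> within ball 0 1)"
    then have "((\<lambda>z. ereal (sph_deriv f z)) \<longlongrightarrow> ereal c) (at \<xi> within ball 0 1)"
      by (rule tendsto_ereal)
    from lim_imp_Limsup[OF nt[OF xi] this]
    show "Limsup (at \<xi> within ball 0 1) (\<lambda>z. ereal (sph_deriv f z)) \<le> ereal c" by simp
  next
    assume le: "Limsup (at \<xi> within ball 0 1) (\<lambda>z. ereal (sph_deriv f z)) \<le> ereal c"
    show "(sph_deriv f \<longlongrightarrow> c) (at \<xi> within ball 0 1)"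
    proof (rule order_tendstoI)
      fix y assume "y < c"
      then show "\<forall>\<^sub>F z in at \<xi> within ball 0 1. y < sph_deriv f z"
        by (intro eventually_mono[OF ev[OF f]]) auto
    next
      fix y assume "c < y"
      then have "Limsup (at \<xi> within ball 0 1) (\<lambda>z. ereal (sph_deriv f z)) < ereal y"
        using le by (simp add: le_less_trans)
      from Limsup_lessD[OF this] show "\<forall>\<^sub>F z in at \<xi> within ball 0 1. sph_deriv f z < y" by simp
    qed
  qed
  show ?thesis
  proof (intro iffI ballI)
    fix \<xi> :: complex assume xi: "\<xi> \<in> sphere 0 1"
    assume "\<forall>\<xi>\<in>sphere (0::complex) 1. \<forall>f\<in>F_class c.
            Limsup (at \<xi> within ball 0 1) (\<lambda>z. ereal (sph_deriv F z))
              \<le> Limsup (at \<xi> within ball 0 1) (\<lambda>z. ereal (sph_deriv f z))"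
    then have "Limsup (at \<xi> within ball 0 1) (\<lambda>z. ereal (sph_deriv F z))
              \<le> Limsup (at \<xi> within ball 0 1) (\<lambda>z. ereal (sph_deriv ?g z))"
      using g(1) xi by blast
    also have "\<dots> \<le> ereal c" using lim_iff[OF g(1) xi] g(2)[OF xi] by simp
    finally show "(sph_deriv F \<longlongrightarrow> c) (at \<xi> within ball 0 1)" using lim_iff[OF F xi] by simp
  next
    fix \<xi> f assume "\<forall>\<xi>\<in>sphere 0 1. (sph_deriv F \<longlongrightarrow> c) (at \<xi> within ball 0 1)"
      and xi: "\<xi> \<in> sphere (0::complex) 1" and f: "f \<in> F_class c"
    then have "Limsup (at \<xi> within ball 0 1) (\<lambda>z. ereal (sph_deriv F z)) \<le> ereal c"
      using lim_iff[OF F xi] by blast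
    also have "\<dots> \<le> Limsup (at \<xi> within ball 0 1) (\<lambda>z. ereal (sph_deriv f z))"
      by (rule ge[OF f xi])
    finally show "Limsup (at \<xi> within ball 0 1) (\<lambda>z. ereal (sph_deriv F z))
              \<le> Limsup (at \<xi> within ball 0 1) (\<lambda>z. ereal (sph_deriv f z))" .
  qed
qed

theorem theorem3p2:
  fixes c :: real and F :: "complex \<Rightarrow> complex"
  assumes "c > 0" and "F \<in> F_class c"
  shows "((\<forall>f\<in>F_class c. sph_deriv f 0 \<le> sph_deriv F 0) \<or>
          (\<forall>f\<in>F_class c. sph_deriv F 0 \<le> sph_deriv f 0))
     \<longleftrightarrow> (\<forall>\<xi>\<in>sphere (0::complex) 1. \<forall>f\<in>F_class c.
            Limsup (at \<xi> within ball 0 1) (\<lambda>z. ereal (sph_deriv F z))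
              \<le> Limsup (at \<xi> within ball 0 1) (\<lambda>z. ereal (sph_deriv f z)))"
  unfolding interior_extremal_iff[OF assms] boundary_extremal_iff[OF assms]
  by (rule extremal_boundary_behaviour_iff[OF assms])

end
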